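(* Consider the telegraph process driven by Bernoulli trials with parameter $p=b/(b+r)\in(0,1)$ and velocities $c>0$, $-v<0$ described in the context, and assume that $U_k$ and $D_k$ are exponentially distributed with rates $\lambda k$ and $\mu k$, $k=1,2,\dots$, respectively, where $\lambda,\mu>0$. For $t>0$ and $-vt<x<ct$ put $\tau_*=\frac{vt+x}{c+v}$. Then for all $t>0$ and $-vt<x<ct$ $$p(x,t\,|\,c)=\frac{1-p}{c+v}\,\frac{\lambda(1-p)e^{(\lambda+2\mu)\tau_*}+p\,e^{\mu(t+\tau_* )}\left[(\lambda+\mu)e^{\lambda\tau_*}-\mu\right]}{\left[p\,e^{\mu t}+(1-p)e^{(\lambda+\mu)\tau_*}\right]^2}$$ and $$p(x,t\,|\,-v)=\frac{p}{c+v}\,\frac{e^{\mu(t+\tau_* )}\left[(\lambda+\mu)e^{\lambda\tau_*}(1-p)+\mu p\right]-\lambda(1-p)e^{(\lambda+2\mu)\tau_*}}{\left[p\,e^{\mu t}+(1-p)e^{(\lambda+\mu)\tau_*}\right]^2}.$$ Hence, for $-vt<x<ct$, $$p(x,t)=\frac{p}{1-p}\,\frac1s\,\frac{\exp\left\{\left(\mu-\frac vs\right)t-\frac1s x\right\}}{\left[1+\frac{p}{1-p}\exp\left\{\left(\mu-\frac vs\right)t-\frac1s x\right\}\right]^2},\qquad s:=\frac{c+v}{\lambda+\mu}.$$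
   Context: Model (Bernoulli scheme, $A=0$). Fix $c,v>0$ and $b,r>0$, and set $p=b/(b+r)$. Let $\{X_n;n\ge1\}$ be i.i.d. with $\mathbb{P}\{X_n=1\}=p=1-\mathbb{P}\{X_n=0\}$. Put $Z_n=c$ if $X_{n+1}=1$ and $Z_n=-v$ if $X_{n+1}=0$, $n\ge0$. Let $\{U_k;k\ge1\}$ and $\{D_k;k\ge1\}$ be mutually independent sequences of independent non-negative random variables, the collection $\{U_k,D_k;k\ge1\}$ being independent of $\{X_n;n\ge1\}$. $U_k$ (resp. $D_k$) is the duration of the $k$-th period during which the particle has velocity $c$ (resp. $-v$): $T_0=0$ and, for $n\ge0$, with $j_n=X_1+\cdots+X_{n+1}$, $T_{n+1}=T_n+U_{j_n}$ if $X_{n+1}=1$ and $T_{n+1}=T_n+D_{n+1-j_n}$ if $X_{n+1}=0$. Let $M_t=\max\{i\ge1:T_i\le t\}$ (with $M_t=0$ if $T_1>t$). The velocity and position at time $t$ are $V_t=Z_{M_t}$ and $S_t=\int_0^tV_s\,ds$, so $S_0=0$ and $V_0=Z_0$. Densities. For $y\in\{-v,c\}$, $t>0$ and $x\in(-vt,ct)$: $p(x,t\,|\,y)=\frac{\partial}{\partial x}\mathbb{P}\{S_t\le x\mid V_0=y\}$ and $p(x,t)=\frac{\partial}{\partial x}\mathbb{P}\{S_t\le x\}$ (the densities of the absolutely continuous component of the law of $S_t$ over $(-vt,ct)$). The constant $p$ (no arguments) denotes the Bernoulli parameter. *)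

theory Defs
  imports "HOL-Probability.Probability"
begin

text \<open>
  All sequences are indexed from 1, so \<open>X 0\<close>, \<open>U 0\<close> and \<open>D 0\<close> are irrelevant.
  The independence assumption says that the whole collection of all \<open>X\<^sub>n\<close>, \<open>U\<^sub>k\<close>, \<open>D\<^sub>k\<close>
  is mutually independent; \<open>X\<close> is embedded into the reals only to give the family one value type.
\<close>

locale bernoulli_scheme = prob_space M for M :: "'a measure" +
  fixes p :: real
    and X :: "nat \<Rightarrow> 'a \<Rightarrow> nat"
    and U D :: "nat \<Rightarrow> 'a \<Rightarrow> real"
  assumes trial_rv: "\<And>n. 1 \<le> n \<Longrightarrow> X n \<in> measurable M (count_space {0, 1})"
    and trial_one: "\<And>n. 1 \<le> n \<Longrightarrow> \<P>(\<omega> in M. X n \<omega> = 1) = p"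
    and trial_zero: "\<And>n. 1 \<le> n \<Longrightarrow> \<P>(\<omega> in M. X n \<omega> = 0) = 1 - p"
    and U_nonneg: "\<And>k. 1 \<le> k \<Longrightarrow> AE \<omega> in M. 0 \<le> U k \<omega>"
    and D_nonneg: "\<And>k. 1 \<le> k \<Longrightarrow> AE \<omega> in M. 0 \<le> D k \<omega>"
    and independent: "indep_vars (\<lambda>_. borel)
          (case_sum (\<lambda>n \<omega>. real (X n \<omega>)) (case_sum U D))
          ({1..} <+> ({1..} <+> {1..}))"

definition velocity_step :: "(nat \<Rightarrow> 'a \<Rightarrow> nat) \<Rightarrow> real \<Rightarrow> real \<Rightarrow> nat \<Rightarrow> 'a \<Rightarrow> real" where
  "velocity_step X c v n \<omega> = (if X (n + 1) \<omega> = 1 then c else - v)"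

definition up_count :: "(nat \<Rightarrow> 'a \<Rightarrow> nat) \<Rightarrow> nat \<Rightarrow> 'a \<Rightarrow> nat" where
  "up_count X n \<omega> = (\<Sum>i = 1..n + 1. X i \<omega>)"

primrec epoch ::
    "(nat \<Rightarrow> 'a \<Rightarrow> nat) \<Rightarrow> (nat \<Rightarrow> 'a \<Rightarrow> real) \<Rightarrow> (nat \<Rightarrow> 'a \<Rightarrow> real) \<Rightarrow> nat \<Rightarrow> 'a \<Rightarrow> real" where
  "epoch X U D 0 \<omega> = 0"
| "epoch X U D (Suc n) \<omega> = epoch X U D n \<omega> +
     (if X (n + 1) \<omega> = 1 then U (up_count X n \<omega>) \<omega> else D (n + 1 - up_count X n \<omega>) \<omega>)"

text \<open>
  If infinitely many epochs lie in \<open>[0, t]\<close>, the maximum below is an unspecified constant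
  (the same for all such \<open>\<omega>\<close>).  For exponential periods with rates linear in \<open>k\<close> this event is null.
\<close>

definition epoch_count ::
    "(nat \<Rightarrow> 'a \<Rightarrow> nat) \<Rightarrow> (nat \<Rightarrow> 'a \<Rightarrow> real) \<Rightarrow> (nat \<Rightarrow> 'a \<Rightarrow> real) \<Rightarrow> real \<Rightarrow> 'a \<Rightarrow> nat" where
  "epoch_count X U D t \<omega> =
     (if epoch X U D 1 \<omega> > t then 0 else Max {i. 1 \<le> i \<and> epoch X U D i \<omega> \<le> t})"

definition velocity ::
    "(nat \<Rightarrow> 'a \<Rightarrow> nat) \<Rightarrow> (nat \<Rightarrow> 'a \<Rightarrow> real) \<Rightarrow> (nat \<Rightarrow> 'a \<Rightarrow> real) \<Rightarrow> real \<Rightarrow> real \<Rightarrow>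
     real \<Rightarrow> 'a \<Rightarrow> real" where
  "velocity X U D c v t \<omega> = velocity_step X c v (epoch_count X U D t \<omega>) \<omega>"

definition position ::
    "(nat \<Rightarrow> 'a \<Rightarrow> nat) \<Rightarrow> (nat \<Rightarrow> 'a \<Rightarrow> real) \<Rightarrow> (nat \<Rightarrow> 'a \<Rightarrow> real) \<Rightarrow> real \<Rightarrow> real \<Rightarrow>
     real \<Rightarrow> 'a \<Rightarrow> real" where
  "position X U D c v t \<omega> = (LBINT u:{0..t}. velocity X U D c v u \<omega>)"

end

theory Submission
  imports Defs
begin

text \<open>
  Plot a trajectory as a staircase in the quadrant whose coordinates are the total time spent moving
  up and the total time spent moving down: every success of the Bernoulli trials contributes a
  horizontal step of length \<open>U k\<close>, every failure a vertical step of length \<open>D k\<close>. At time \<open>t\<close>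
  the particle is where the staircase meets the antidiagonal \<open>u + d = t\<close>, and
  \<open>S\<^sub>t = (c + v) A\<^sub>t - v t\<close> with \<open>A\<^sub>t\<close> the up-time at \<open>t\<close>. Since the staircase is monotone,
  for \<open>0 \<le> a < t\<close> the event \<open>A\<^sub>t > a\<close> occurs exactly when it passes the vertical line \<open>u = a\<close> below height \<open>t - a\<close>
  (lemma \<open>position_gt_iff_crossing\<close>).

  The second observation is that partial sums of independent exponential variables with rates
  \<open>l, 2 l, 3 l, \<dots>\<close> are the jump times of a Yule process, so that
  \<open>P (W\<^sub>1 + \<dots> + W\<^sub>n \<le> s) = (1 - exp (- l s)) ^ n\<close> (lemma \<open>prob_sum_exponential_le\<close>). Put
  \<open>\<theta> = exp (- lam a)\<close> and \<open>\<eta> = exp (- \<mu> (t - a))\<close>. If the first \<open>n\<close> trials contain \<open>j\<close> successes, then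
  trial \<open>n + 1\<close> is a success whose horizontal step crosses \<open>u = a\<close> below height \<open>t - a\<close> with
  probability \<open>p \<theta> (1 - \<theta>) ^ j (1 - \<eta>) ^ (n - j)\<close>. This is multiplicative over the trials, so
  averaging over words of length \<open>n\<close> replaces every trial by the factor
  \<open>p (1 - \<theta>) + (1 - p) (1 - \<eta>)\<close>, or by one of its two summands if the outcome of the trial is
  prescribed (lemma \<open>prob_crossing\<close>). The sum over \<open>n\<close> is a geometric series; prescribing the
  first trial, which decides the initial velocity, gives the conditional laws. The three distribution
  functions are elementary functions of the up-time (lemmas \<open>position_cdf_joint\<close> and \<open>position_cdf\<close>), and
  their derivatives are the densities.
\<close>

section \<open>Sums of exponential variables with linearly growing rates\<close>

context prob_space
begin

text \<open>
  Conditioning on the last summand \<open>x\<close> turns the induction step into the integral over \<open>[0, s]\<close> of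
  \<open>(n + 1) l exp (- (n + 1) l x) (1 - exp (- l (s - x))) ^ n\<close>. Moving the factor \<open>exp (- n l x)\<close> into
  the power gives the derivative of \<open>- (exp (- l x) - exp (- l s)) ^ (n + 1)\<close>.
\<close>

lemma prob_sum_exponential_le:
  fixes W :: "nat \<Rightarrow> 'a \<Rightarrow> real"
  assumes indep: "indep_vars (\<lambda>_. borel) W {1..}" and l: "0 < l"
    and dist: "\<And>k. 1 \<le> k \<Longrightarrow> distributed M lborel (W k) (exponential_density (l * real k))"
  shows "\<P>(\<omega> in M. (\<Sum>k=1..n. W k \<omega>) \<le> s) = (if s < 0 then 0 else (1 - exp (- l * s)) ^ n)"
proof (induction n arbitrary: s)
  case 0
  then show ?case by (auto simp: prob_space)
next
  case (Suc n)
  define S where "S = (\<lambda>\<omega>. \<Sum>k=1..n. W k \<omega>)"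
  define F where "F = (\<lambda>s. if s < 0 then 0 else (1 - exp (- l * s)) ^ n)"
  have ind: "indep_var borel (W (Suc n)) borel S"
    unfolding S_def
    by (rule indep_vars_sum) (auto intro: indep_vars_subset[OF indep])
  then have [measurable]: "random_variable borel (W (Suc n))" "random_variable borel S"
    by (auto simp: indep_var_distribution_eq)
  interpret S: prob_space "distr M borel S" by (rule prob_space_distr) simp
  have F: "emeasure (distr M borel S) {..y} = ennreal (F y)" for y
  proof -
    have "S -` {..y} \<inter> space M = {\<omega>\<in>space M. (\<Sum>k=1..n. W k \<omega>) \<le> y}"
      by (auto simp: S_def)
    then have "emeasure (distr M borel S) {..y} = ennreal (\<P>(\<omega> in M. (\<Sum>k=1..n. W k \<omega>) \<le> y))"
      by (subst emeasure_distr) (simp_all only: emeasure_eq_measure, measurable)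
    then show ?thesis by (simp only: Suc F_def)
  qed
  have F_nonneg: "0 \<le> F y" for y using l by (simp add: F_def)
  have [measurable]: "F \<in> borel_measurable borel" unfolding F_def by measurable
  have W: "distr M borel (W (Suc n)) = density lborel (exponential_density (l * real (Suc n)))"
    using distributed_distr_eq_density[OF dist[of "Suc n"]] by (simp cong: distr_cong)
  have half: "{z::real\<times>real. fst z + snd z \<le> s} \<in> sets (borel \<Otimes>\<^sub>M borel)"
    unfolding borel_prod by (intro borel_closed closed_Collect_le continuous_intros)
  have split: "(\<Sum>k=1..Suc n. W k \<omega>) = W (Suc n) \<omega> + S \<omega>" for \<omega>
    by (simp add: S_def)
  have "emeasure M {\<omega>\<in>space M. (\<Sum>k=1..Suc n. W k \<omega>) \<le> s}
      = emeasure (distr M (borel \<Otimes>\<^sub>M borel) (\<lambda>\<omega>. (W (Suc n) \<omega>, S \<omega>))) {z. fst z + snd z \<le> s}"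
    unfolding split by (subst emeasure_distr) (auto simp: half intro!: arg_cong[where f="emeasure M"])
  also have "\<dots> = emeasure (distr M borel (W (Suc n)) \<Otimes>\<^sub>M distr M borel S) {z. fst z + snd z \<le> s}"
    using ind by (simp add: indep_var_distribution_eq)
  also have "\<dots> = (\<integral>\<^sup>+x. emeasure (distr M borel S) {..s - x} \<partial>distr M borel (W (Suc n)))"
  proof (subst S.emeasure_pair_measure_alt)
    show "{z. fst z + snd z \<le> s} \<in> sets (distr M borel (W (Suc n)) \<Otimes>\<^sub>M distr M borel S)"
      using half by (simp cong: sets_pair_measure_cong)
    show "(\<integral>\<^sup>+ x. emeasure (distr M borel S) (Pair x -` {z. fst z + snd z \<le> s}) \<partial>distr M borel (W (Suc n)))
      = (\<integral>\<^sup>+x. emeasure (distr M borel S) {..s - x} \<partial>distr M borel (W (Suc n)))"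
      by (auto intro!: nn_integral_cong arg_cong[where f="emeasure (distr M borel S)"])
  qed
  also have "\<dots> = (\<integral>\<^sup>+x. ennreal (exponential_density (l * real (Suc n)) x) * ennreal (F (s - x)) \<partial>lborel)"
    unfolding W F by (subst nn_integral_density) auto
  also have "\<dots> = (\<integral>\<^sup>+x. ennreal (real (Suc n) * (exp (- l * x) - exp (- l * s)) ^ n * (l * exp (- l * x)))
      * indicator {0..s} x \<partial>lborel)"
  proof (intro nn_integral_cong)
    fix x :: real
    show "ennreal (exponential_density (l * real (Suc n)) x) * ennreal (F (s - x))
       = ennreal (real (Suc n) * (exp (- l * x) - exp (- l * s)) ^ n * (l * exp (- l * x))) * indicator {0..s} x"
    proof (cases "0 \<le> x \<and> x \<le> s")
      case True
      have "- x * (l * real (Suc n)) = real (Suc n) * (- l * x)"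
        by simp
      then have pow: "exp (- x * (l * real (Suc n))) = exp (- l * x) * exp (- l * x) ^ n"
        by (simp only: exp_of_nat_mult power_Suc)
      have "exp (- x * (l * real (Suc n))) * (1 - exp (- l * (s - x))) ^ n
          = exp (- l * x) * (exp (- l * x) * (1 - exp (- l * (s - x)))) ^ n"
        by (simp only: power_mult_distrib pow mult.assoc)
      also have "exp (- l * x) * (1 - exp (- l * (s - x))) = exp (- l * x) - exp (- l * s)"
        by (simp add: algebra_simps exp_add[symmetric])
      finally have "exponential_density (l * real (Suc n)) x * F (s - x)
          = real (Suc n) * (exp (- l * x) - exp (- l * s)) ^ n * (l * exp (- l * x))"
        using True by (simp only: F_def exponential_density_def not_le[symmetric] diff_ge_0_iff_ge
            if_False not_True_eq_False simp_thms)
          (simp only: mult.assoc, simp only: mult_ac)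
      moreover have "0 \<le> exponential_density (l * real (Suc n)) x"
        using l by (intro erlang_density_nonneg) auto
      ultimately show ?thesis
        using True F_nonneg[of "s - x"]
        by (simp only: ennreal_mult[symmetric] indicator_simps atLeastAtMost_iff mult_1_right)
    next
      case False
      then show ?thesis by (auto simp: exponential_density_def F_def)
    qed
  qed
  also have "\<dots> = ennreal (if s < 0 then 0 else (1 - exp (- l * s)) ^ Suc n)"
  proof (cases "s < 0")
    case False
    define G where "G = (\<lambda>x. - ((exp (- l * x) - exp (- l * s)) ^ Suc n))"
    have "(\<integral>\<^sup>+x. ennreal (real (Suc n) * (exp (- l * x) - exp (- l * s)) ^ n * (l * exp (- l * x)))
      * indicator {0..s} x \<partial>lborel) = G s - G 0"
    proof (rule nn_integral_FTC_Icc)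
      show "(\<lambda>x. real (Suc n) * (exp (- l * x) - exp (- l * s)) ^ n * (l * exp (- l * x))) \<in> borel_measurable borel"
        by measurable
      show "(G has_real_derivative real (Suc n) * (exp (- l * x) - exp (- l * s)) ^ n * (l * exp (- l * x))) (at x)" for x
        unfolding G_def by (rule derivative_eq_intros refl | simp)+
      show "0 \<le> real (Suc n) * (exp (- l * x) - exp (- l * s)) ^ n * (l * exp (- l * x))" if "x \<in> {0..s}" for x
        using l that by (simp del: of_nat_Suc)
    qed (use False in auto)
    then show ?thesis using False by (simp add: G_def)
  qed simp
  finally show ?case
    using l by (auto simp: emeasure_eq_measure split: if_splits)
qed

text \<open>
  The strict version needs \<open>s > 0\<close>, because the empty sum is an atom at \<open>0\<close>. It follows from the
  preceding formula at \<open>r < s\<close> and the continuity of its right-hand side.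
\<close>

lemma prob_sum_exponential_less:
  fixes W :: "nat \<Rightarrow> 'a \<Rightarrow> real"
  assumes indep: "indep_vars (\<lambda>_. borel) W {1..}" and l: "0 < l"
    and dist: "\<And>k. 1 \<le> k \<Longrightarrow> distributed M lborel (W k) (exponential_density (l * real k))"
    and s: "0 < s"
  shows "\<P>(\<omega> in M. (\<Sum>k=1..n. W k \<omega>) < s) = (1 - exp (- l * s)) ^ n"
proof (rule antisym)
  have [measurable]: "random_variable borel (W k)" if "1 \<le> k" for k
    using dist[OF that] by (simp add: distributed_def)
  note le = prob_sum_exponential_le[OF indep l dist]
  show "\<P>(\<omega> in M. (\<Sum>k=1..n. W k \<omega>) < s) \<le> (1 - exp (- l * s)) ^ n"
  proof -
    have "\<P>(\<omega> in M. (\<Sum>k=1..n. W k \<omega>) < s) \<le> \<P>(\<omega> in M. (\<Sum>k=1..n. W k \<omega>) \<le> s)"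
      by (intro finite_measure_mono) auto
    then show ?thesis using s by (simp only: le) simp
  qed
  have "((\<lambda>r. (1 - exp (- l * r)) ^ n) \<longlongrightarrow> (1 - exp (- l * s)) ^ n) (at_left s)"
    by (intro tendsto_intros)
  moreover have "\<forall>\<^sub>F r in at_left s. (1 - exp (- l * r)) ^ n \<le> \<P>(\<omega> in M. (\<Sum>k=1..n. W k \<omega>) < s)"
  proof -
    have "(1 - exp (- l * r)) ^ n \<le> \<P>(\<omega> in M. (\<Sum>k=1..n. W k \<omega>) < s)" if "0 < r" "r < s" for r
    proof -
      have "(1 - exp (- l * r)) ^ n = \<P>(\<omega> in M. (\<Sum>k=1..n. W k \<omega>) \<le> r)"
        using that by (subst le) auto
      also have "\<dots> \<le> \<P>(\<omega> in M. (\<Sum>k=1..n. W k \<omega>) < s)"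
        using that by (auto intro!: finite_measure_mono)
      finally show ?thesis .
    qed
    then show ?thesis using eventually_at_left_real[OF s] by (auto elim: eventually_mono)
  qed
  ultimately show "(1 - exp (- l * s)) ^ n \<le> \<P>(\<omega> in M. (\<Sum>k=1..n. W k \<omega>) < s)"
    by (intro tendsto_upperbound) auto
qed

lemma AE_sum_exponential_unbounded:
  fixes W :: "nat \<Rightarrow> 'a \<Rightarrow> real"
  assumes indep: "indep_vars (\<lambda>_. borel) W {1..}" and l: "0 < l"
    and dist: "\<And>k. 1 \<le> k \<Longrightarrow> distributed M lborel (W k) (exponential_density (l * real k))"
  shows "AE \<omega> in M. \<exists>n. s < (\<Sum>k=1..n. W k \<omega>)"
proof -
  have [measurable]: "random_variable borel (W k)" if "1 \<le> k" for k
    using dist[OF that] by (simp add: distributed_def)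
  define r where "r = max 0 s"
  define N where "N = {\<omega>\<in>space M. \<forall>n. (\<Sum>k=1..n. W k \<omega>) \<le> r}"
  have [measurable]: "N \<in> events" unfolding N_def by measurable
  have "prob N \<le> (1 - exp (- l * r)) ^ n" for n
  proof -
    have "prob N \<le> \<P>(\<omega> in M. (\<Sum>k=1..n. W k \<omega>) \<le> r)"
      unfolding N_def by (intro finite_measure_mono) auto
    then show ?thesis
      by (subst (asm) prob_sum_exponential_le[OF indep l dist]) (auto simp: r_def)
  qed
  moreover have "(\<lambda>n. (1 - exp (- l * r)) ^ n) \<longlonglongrightarrow> 0"
    using l by (intro LIMSEQ_power_zero) (auto simp: r_def max_def)
  ultimately have "prob N \<le> 0"
    by (intro tendsto_lowerbound[of _ 0 sequentially]) auto
  then have "emeasure M N = 0" by (simp add: emeasure_eq_measure measure_le_0_iff)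
  then show ?thesis
    by (intro AE_I[of _ _ N]) (auto simp: N_def r_def not_less le_max_iff_disj)
qed

lemma AE_exponential_pos:
  assumes "distributed M lborel Y (exponential_density l)" "0 < l"
  shows "AE \<omega> in M. 0 < Y \<omega>"
proof (rule AE_prob_1[of "{\<omega>\<in>space M. 0 < Y \<omega>}", THEN AE_mp])
  show "\<P>(\<omega> in M. 0 < Y \<omega>) = 1"
    using exponential_distributedD_gt[OF assms(1) order_refl assms(2)] by simp
qed auto

text \<open>
  The event says that the Yule process jumps exactly \<open>n\<close> times up to \<open>s\<close>. Its probability is the
  difference of two consecutive powers of \<open>1 - exp (- l s)\<close>, so the number of jumps is geometric.
\<close>

lemma prob_sum_exponential_between:
  fixes W :: "nat \<Rightarrow> 'a \<Rightarrow> real"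
  assumes indep: "indep_vars (\<lambda>_. borel) W {1..}" and l: "0 < l"
    and dist: "\<And>k. 1 \<le> k \<Longrightarrow> distributed M lborel (W k) (exponential_density (l * real k))"
    and s: "0 \<le> s"
  shows "\<P>(\<omega> in M. (\<Sum>k=1..n. W k \<omega>) \<le> s \<and> s < (\<Sum>k=1..Suc n. W k \<omega>))
           = exp (- l * s) * (1 - exp (- l * s)) ^ n"
proof -
  have [measurable]: "random_variable borel (W k)" if "1 \<le> k" for k
    using dist[OF that] by (simp add: distributed_def)
  note le = prob_sum_exponential_le[OF indep l dist]
  have [measurable]: "{\<omega>\<in>space M. (\<Sum>k=1..n. W k \<omega>) \<le> s} \<in> events" for n s
    by measurable
  have "AE \<omega> in M. 0 < W (Suc n) \<omega>"
    using l by (intro AE_exponential_pos[OF dist]) auto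
  then have "\<P>(\<omega> in M. (\<Sum>k=1..n. W k \<omega>) \<le> s \<and> s < (\<Sum>k=1..Suc n. W k \<omega>))
      = prob ({\<omega>\<in>space M. (\<Sum>k=1..n. W k \<omega>) \<le> s} - {\<omega>\<in>space M. (\<Sum>k=1..Suc n. W k \<omega>) \<le> s})"
    by (intro arg_cong[where f=prob]) auto
  also have "\<dots> = \<P>(\<omega> in M. (\<Sum>k=1..n. W k \<omega>) \<le> s)
      - prob ({\<omega>\<in>space M. (\<Sum>k=1..n. W k \<omega>) \<le> s} \<inter> {\<omega>\<in>space M. (\<Sum>k=1..Suc n. W k \<omega>) \<le> s})"
    by (rule finite_measure_Diff') auto
  also have "prob ({\<omega>\<in>space M. (\<Sum>k=1..n. W k \<omega>) \<le> s} \<inter> {\<omega>\<in>space M. (\<Sum>k=1..Suc n. W k \<omega>) \<le> s})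
      = \<P>(\<omega> in M. (\<Sum>k=1..Suc n. W k \<omega>) \<le> s)"
    using \<open>AE \<omega> in M. 0 < W (Suc n) \<omega>\<close> by (intro finite_measure_eq_AE) auto
  finally show ?thesis
    using s by (simp only: le) (simp add: algebra_simps)
qed

end

section \<open>Staircase trajectories\<close>

text \<open>
  \<open>ones X n\<close> and \<open>up_count X n\<close> differ by an index shift: the former counts the successes among the
  first \<open>n\<close> trials, the latter among the first \<open>n + 1\<close>. The pairs \<open>(up_time X U n, down_time X D n)\<close>
  are the vertices of the staircase.
\<close>

definition ones :: "(nat \<Rightarrow> 'a \<Rightarrow> nat) \<Rightarrow> nat \<Rightarrow> 'a \<Rightarrow> nat" where
  "ones X n \<omega> = (\<Sum>i=1..n. X i \<omega>)"

definition up_time :: "(nat \<Rightarrow> 'a \<Rightarrow> nat) \<Rightarrow> (nat \<Rightarrow> 'a \<Rightarrow> real) \<Rightarrow> nat \<Rightarrow> 'a \<Rightarrow> real" where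
  "up_time X U n \<omega> = (\<Sum>k=1..ones X n \<omega>. U k \<omega>)"

definition down_time :: "(nat \<Rightarrow> 'a \<Rightarrow> nat) \<Rightarrow> (nat \<Rightarrow> 'a \<Rightarrow> real) \<Rightarrow> nat \<Rightarrow> 'a \<Rightarrow> real" where
  "down_time X D n \<omega> = (\<Sum>k=1..n - ones X n \<omega>. D k \<omega>)"

lemma ones_0 [simp]: "ones X 0 \<omega> = 0"
  by (simp add: ones_def)

lemma ones_Suc: "ones X (Suc n) \<omega> = ones X n \<omega> + X (Suc n) \<omega>"
  by (simp add: ones_def)

lemma up_time_0 [simp]: "up_time X U 0 \<omega> = 0"
  by (simp add: up_time_def)

lemma down_time_0 [simp]: "down_time X D 0 \<omega> = 0"
  by (simp add: down_time_def)

text \<open>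
  Step \<open>n + 1\<close> is horizontal and crosses the vertical line at abscissa \<open>a\<close> below height \<open>d\<close>.
\<close>

definition crossing ::
    "(nat \<Rightarrow> 'a \<Rightarrow> nat) \<Rightarrow> (nat \<Rightarrow> 'a \<Rightarrow> real) \<Rightarrow> (nat \<Rightarrow> 'a \<Rightarrow> real) \<Rightarrow> real \<Rightarrow> real \<Rightarrow>
     nat \<Rightarrow> 'a \<Rightarrow> bool" where
  "crossing X U D a d n \<omega> \<longleftrightarrow> X (Suc n) \<omega> = 1 \<and> up_time X U n \<omega> \<le> a \<and> a < up_time X U (Suc n) \<omega>
     \<and> down_time X D n \<omega> < d"

text \<open>
  Identities between the epochs and the staircase hold as soon as the trials are 0 or 1, that is, at
  every sample point, and are therefore available for measurability; non-negative durations, and with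
  them monotonicity, are only almost sure.
\<close>

locale trial_path =
  fixes X :: "nat \<Rightarrow> 'a \<Rightarrow> nat" and U D :: "nat \<Rightarrow> 'a \<Rightarrow> real" and \<omega> :: 'a
  assumes letter: "\<And>n. 1 \<le> n \<Longrightarrow> X n \<omega> = 0 \<or> X n \<omega> = 1"
begin

lemma ones_le: "ones X n \<omega> \<le> n"
proof (induction n)
  case (Suc n)
  then show ?case using letter[of "Suc n"] by (auto simp: ones_Suc)
qed simp

lemma up_time_Suc:
  "up_time X U (Suc n) \<omega> = up_time X U n \<omega> + (if X (Suc n) \<omega> = 1 then U (Suc (ones X n \<omega>)) \<omega> else 0)"
  using letter[of "Suc n"] by (auto simp: up_time_def ones_Suc)

lemma down_time_Suc:
  "down_time X D (Suc n) \<omega>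
     = down_time X D n \<omega> + (if X (Suc n) \<omega> = 1 then 0 else D (Suc (n - ones X n \<omega>)) \<omega>)"
  using letter[of "Suc n"] ones_le[of n] by (auto simp: down_time_def ones_Suc Suc_diff_le)

lemma epoch_eq: "epoch X U D n \<omega> = up_time X U n \<omega> + down_time X D n \<omega>"
proof (induction n)
  case (Suc n)
  have "up_count X n \<omega> = ones X n \<omega> + X (Suc n) \<omega>"
    by (simp add: up_count_def ones_def)
  then show ?case
    using Suc letter[of "Suc n"] ones_le[of n]
    by (auto simp: up_time_Suc down_time_Suc Suc_diff_le)
qed simp

end

locale telegraph_path = trial_path X U D \<omega>
  for X :: "nat \<Rightarrow> 'a \<Rightarrow> nat" and U D :: "nat \<Rightarrow> 'a \<Rightarrow> real" and \<omega> :: 'a +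
  assumes up_nonneg: "\<And>k. 1 \<le> k \<Longrightarrow> 0 \<le> U k \<omega>"
    and down_nonneg: "\<And>k. 1 \<le> k \<Longrightarrow> 0 \<le> D k \<omega>"
begin

lemma up_time_mono: "m \<le> n \<Longrightarrow> up_time X U m \<omega> \<le> up_time X U n \<omega>"
  by (rule lift_Suc_mono_le[of "\<lambda>n. up_time X U n \<omega>"]) (auto simp: up_time_Suc up_nonneg)

lemma down_time_mono: "m \<le> n \<Longrightarrow> down_time X D m \<omega> \<le> down_time X D n \<omega>"
  by (rule lift_Suc_mono_le[of "\<lambda>n. down_time X D n \<omega>"]) (auto simp: down_time_Suc down_nonneg)

lemma epoch_mono: "m \<le> n \<Longrightarrow> epoch X U D m \<omega> \<le> epoch X U D n \<omega>"
  unfolding epoch_eq by (intro add_mono up_time_mono down_time_mono)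

lemma epoch_count_eq:
  assumes "epoch X U D n \<omega> \<le> u" "u < epoch X U D (Suc n) \<omega>"
  shows "epoch_count X U D u \<omega> = n"
proof (cases "n = 0")
  case True
  then show ?thesis using assms by (simp add: epoch_count_def del: epoch.simps)
next
  case False
  have "{i. 1 \<le> i \<and> epoch X U D i \<omega> \<le> u} = {1..n}"
    using assms epoch_mono[of "Suc n"] epoch_mono[of _ n]
    by (auto simp: not_less_eq_eq[symmetric] simp del: epoch.simps) (meson order.trans not_le not_less_eq_eq)+
  moreover have "\<not> epoch X U D 1 \<omega> > u"
    using epoch_mono[of 1 n] False assms by simp
  moreover have "Max {1..n} = n"
    using False by (intro Max_eqI) auto
  ultimately show ?thesis by (simp only: epoch_count_def if_False)
qed

lemma velocity_eq:
  assumes "epoch X U D n \<omega> \<le> u" "u < epoch X U D (Suc n) \<omega>"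
  shows "velocity X U D c v u \<omega> = velocity_step X c v n \<omega>"
  using epoch_count_eq[OF assms] by (simp add: velocity_def)

text \<open>
  Half-open intervals make the velocity equal to a constant on the whole of each piece, whatever
  happens at the epochs themselves, and they allow empty pieces.
\<close>

lemma velocity_integral_epoch:
  "set_integrable lborel {0..<epoch X U D n \<omega>} (\<lambda>u. velocity X U D c v u \<omega>)
   \<and> (LBINT u:{0..<epoch X U D n \<omega>}. velocity X U D c v u \<omega>) = c * up_time X U n \<omega> - v * down_time X D n \<omega>"
proof (induction n)
  case 0
  then show ?case by (simp add: set_integrable_def set_lebesgue_integral_def)
next
  case (Suc n)
  let ?T = "\<lambda>n. epoch X U D n \<omega>" and ?V = "\<lambda>u. velocity X U D c v u \<omega>"
  have le: "0 \<le> ?T n" "?T n \<le> ?T (Suc n)"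
    using epoch_mono[of 0 n] epoch_mono[of n "Suc n"] by auto
  have const: "?V u = velocity_step X c v n \<omega>" if "u \<in> {?T n..<?T (Suc n)}" for u
    using that by (intro velocity_eq) auto
  have int: "set_integrable lborel {?T n..<?T (Suc n)} ?V"
    using const by (subst set_integrable_cong[OF refl refl, where f'="\<lambda>_. velocity_step X c v n \<omega>"])
      (auto simp: set_integrable_def emeasure_lborel_Icc_eq le simp del: epoch.simps
          intro!: integrable_real_indicator)
  have "(LBINT u:{?T n..<?T (Suc n)}. ?V u) = (LBINT u:{?T n..<?T (Suc n)}. velocity_step X c v n \<omega>)"
    using const by (intro set_lebesgue_integral_cong) auto
  also have "\<dots> = velocity_step X c v n \<omega> * (?T (Suc n) - ?T n)"
    using le by (simp add: set_lebesgue_integral_def)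
  finally have val: "(LBINT u:{?T n..<?T (Suc n)}. ?V u) = velocity_step X c v n \<omega> * (?T (Suc n) - ?T n)" .
  have Un: "{0..<?T (Suc n)} = {0..<?T n} \<union> {?T n..<?T (Suc n)}"
    using le by (simp add: ivl_disj_un_two)
  show ?case unfolding Un
  proof (intro conjI)
    show "set_integrable lborel ({0..<?T n} \<union> {?T n..<?T (Suc n)}) ?V"
      using Suc int by (intro set_integrable_Un) auto
    have "(LBINT u:{0..<?T n} \<union> {?T n..<?T (Suc n)}. ?V u)
        = c * up_time X U n \<omega> - v * down_time X D n \<omega> + velocity_step X c v n \<omega> * (?T (Suc n) - ?T n)"
      using Suc int val by (subst set_integral_Un) auto
    also have "\<dots> = c * up_time X U (Suc n) \<omega> - v * down_time X D (Suc n) \<omega>"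
      unfolding epoch_eq by (simp add: velocity_step_def up_time_Suc down_time_Suc algebra_simps)
    finally show "(LBINT u:{0..<?T n} \<union> {?T n..<?T (Suc n)}. ?V u)
        = c * up_time X U (Suc n) \<omega> - v * down_time X D (Suc n) \<omega>" .
  qed
qed

lemma position_eq:
  assumes "epoch X U D n \<omega> \<le> t" "t < epoch X U D (Suc n) \<omega>"
  shows "position X U D c v t \<omega> = c * up_time X U n \<omega> - v * down_time X D n \<omega>
           + velocity_step X c v n \<omega> * (t - epoch X U D n \<omega>)"
proof -
  let ?T = "epoch X U D n \<omega>" and ?V = "\<lambda>u. velocity X U D c v u \<omega>"
  have le: "0 \<le> ?T"
    using epoch_mono[of 0 n] by auto
  have const: "?V u = velocity_step X c v n \<omega>" if "u \<in> {?T..t}" for u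
    using that assms by (intro velocity_eq) auto
  have int: "set_integrable lborel {?T..t} ?V"
    using const by (subst set_integrable_cong[OF refl refl, where f'="\<lambda>_. velocity_step X c v n \<omega>"])
      (auto simp: set_integrable_def emeasure_lborel_Icc_eq le simp del: epoch.simps
          intro!: integrable_real_indicator)
  have "(LBINT u:{?T..t}. ?V u) = (LBINT u:{?T..t}. velocity_step X c v n \<omega>)"
    using const by (intro set_lebesgue_integral_cong) auto
  also have "\<dots> = velocity_step X c v n \<omega> * (t - ?T)"
    using assms by (simp add: set_lebesgue_integral_def)
  finally have val: "(LBINT u:{?T..t}. ?V u) = velocity_step X c v n \<omega> * (t - ?T)" .
  have "{0..t} = {0..<?T} \<union> {?T..t}"
    using le assms by (simp add: ivl_disj_un_two)
  then show ?thesis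
    unfolding position_def using int val velocity_integral_epoch[of n c v]
    by (subst \<open>{0..t} = _\<close>, subst set_integral_Un) auto
qed

text \<open>
  Let \<open>n + 1\<close> be the step during which time \<open>t\<close> is reached, and \<open>A\<close> the up-time at \<open>t\<close>. If \<open>A > a\<close>,
  the first vertex with abscissa above \<open>a\<close> ends a horizontal step that starts no later than step
  \<open>n + 1\<close>, so its height is at most the down-time at \<open>t\<close>, which is \<open>t - A < t - a\<close>. Conversely, a
  crossing below height \<open>t - a\<close> happens on \<open>u + d < t\<close>, hence before time \<open>t\<close>, and the up-time only
  grows afterwards.
\<close>

lemma position_gt_iff_crossing:
  assumes pos: "0 < c" "0 < v" and t: "0 < t" and a: "0 \<le> a" and N: "t < epoch X U D N \<omega>"
  shows "(c + v) * a - v * t < position X U D c v t \<omega> \<longleftrightarrow> (\<exists>n. crossing X U D a (t - a) n \<omega>)"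
proof -
  define K where "K = (LEAST n. t < epoch X U D n \<omega>)"
  have K: "t < epoch X U D K \<omega>" unfolding K_def using N by (rule LeastI)
  then have "K \<noteq> 0" using t by (intro notI) simp
  then obtain n where n: "K = Suc n" by (cases K) auto
  have n1: "epoch X U D n \<omega> \<le> t" using not_less_Least[of n "\<lambda>n. t < epoch X U D n \<omega>"]
    by (simp add: K_def[symmetric] n)
  note n2 = K[unfolded n]
  define A where "A = up_time X U n \<omega> + (if X (Suc n) \<omega> = 1 then t - epoch X U D n \<omega> else 0)"
  have "position X U D c v t \<omega> = (c + v) * A - v * t"
    using position_eq[OF n1 n2, of c v]
    by (auto simp: A_def velocity_step_def epoch_eq algebra_simps split: if_splits)
  then have "(c + v) * a - v * t < position X U D c v t \<omega> \<longleftrightarrow> a < A"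
    using pos by simp
  also have "\<dots> \<longleftrightarrow> (\<exists>n. crossing X U D a (t - a) n \<omega>)"
  proof
    assume "a < A"
    have le: "A \<le> up_time X U (Suc n) \<omega>"
      using n2 unfolding epoch_eq A_def by (auto simp: up_time_Suc down_time_Suc)
    define m where "m = (LEAST m. a < up_time X U m \<omega>)"
    have ex: "a < up_time X U (Suc n) \<omega>" using le \<open>a < A\<close> by simp
    then have m: "a < up_time X U m \<omega>" unfolding m_def by (rule LeastI)
    then have "m \<noteq> 0" using a by (intro notI) simp
    then obtain k where k: "m = Suc k" by (cases m) auto
    have "up_time X U k \<omega> \<le> a" using not_less_Least[of k "\<lambda>m. a < up_time X U m \<omega>"]
      by (simp add: m_def[symmetric] k)
    moreover have "k \<le> n" using Least_le[of "\<lambda>m. a < up_time X U m \<omega>", OF ex] by (simp add: m_def[symmetric] k)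
    then have "down_time X D k \<omega> < t - a"
      using down_time_mono[of k n] n1 \<open>a < A\<close> unfolding A_def epoch_eq by (auto split: if_splits)
    moreover have "X (Suc k) \<omega> = 1"
      using m \<open>up_time X U k \<omega> \<le> a\<close> by (auto simp: k up_time_Suc split: if_splits)
    ultimately show "\<exists>n. crossing X U D a (t - a) n \<omega>" using m by (auto simp: crossing_def k)
  next
    assume "\<exists>n. crossing X U D a (t - a) n \<omega>"
    then obtain k where k: "crossing X U D a (t - a) k \<omega>" by blast
    have "k \<le> n"
    proof (rule ccontr)
      assume "\<not> k \<le> n"
      then have "up_time X U (Suc n) \<omega> \<le> up_time X U k \<omega>" "down_time X D (Suc n) \<omega> \<le> down_time X D k \<omega>"
        by (auto intro!: up_time_mono down_time_mono)
      then show False using k n2 unfolding crossing_def epoch_eq by auto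
    qed
    show "a < A"
    proof (cases "k = n")
      case True
      then show ?thesis using k by (auto simp: crossing_def A_def epoch_eq)
    next
      case False
      then have "up_time X U (Suc k) \<omega> \<le> up_time X U n \<omega>" using \<open>k \<le> n\<close> by (intro up_time_mono) auto
      then show ?thesis using k n1 by (auto simp: crossing_def A_def)
    qed
  qed
  finally show ?thesis .
qed

end

section \<open>Measurability of the trajectory\<close>

text \<open>
  The probability space is not assumed to be complete, so exceptional null sets have to be measurable
  as well: everything below holds at every sample point, including those with negative durations or
  infinitely many epochs in a bounded interval. The durations with the random indices occurring in
  the epochs are handled by splitting according to the countably many values of the index.
\<close>

context bernoulli_scheme
begin

lemma trial_path: "\<omega> \<in> space M \<Longrightarrow> trial_path X \<omega>"
  using measurable_space[OF trial_rv] by (force simp: trial_path_def)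

lemma measurable_trial [measurable]:
  assumes "1 \<le> n"
  shows "X n \<in> measurable M (count_space UNIV)"
  using trial_rv[OF assms] by (rule measurable_compose) simp

lemma measurable_duration [measurable]:
  assumes "1 \<le> k"
  shows "U k \<in> borel_measurable M" "D k \<in> borel_measurable M"
proof -
  have "random_variable borel (case_sum (\<lambda>n \<omega>. real (X n \<omega>)) (case_sum U D) i)"
    if "i \<in> {1..} <+> ({1..} <+> {1..})" for i
    using independent that unfolding indep_vars_def by blast
  from this[of "Inr (Inl k)"] this[of "Inr (Inr k)"] assms
  show "U k \<in> borel_measurable M" "D k \<in> borel_measurable M"
    by auto
qed

lemma measurable_ones [measurable]: "ones X n \<in> measurable M (count_space UNIV)"
proof (induction n)
  case (Suc n)
  have "(\<lambda>\<omega>. j + X (Suc n) \<omega>) \<in> measurable M (count_space UNIV)" for j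
    by (rule measurable_compose[OF measurable_trial]) auto
  from measurable_compose_countable[OF this Suc] show ?case
    by (simp add: ones_Suc[abs_def] ones_Suc cong: measurable_cong)
qed (simp add: ones_def[abs_def])

lemma measurable_up_time [measurable]: "up_time X U n \<in> borel_measurable M"
proof -
  have "(\<lambda>\<omega>. \<Sum>k=1..j. U k \<omega>) \<in> borel_measurable M" for j
    by measurable
  from measurable_compose_countable[OF this measurable_ones] show ?thesis
    by (simp add: up_time_def[abs_def])
qed

lemma measurable_down_time [measurable]: "down_time X D n \<in> borel_measurable M"
proof -
  have "(\<lambda>\<omega>. \<Sum>k=1..n - j. D k \<omega>) \<in> borel_measurable M" for j
    by measurable
  from measurable_compose_countable[OF this measurable_ones] show ?thesis
    by (simp add: down_time_def[abs_def])
qed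

lemma measurable_crossing [measurable]: "Measurable.pred M (crossing X U D a d n)"
  unfolding crossing_def[abs_def] by measurable

lemma measurable_epoch [measurable]: "epoch X U D n \<in> borel_measurable M"
  by (subst measurable_cong[of _ _ "\<lambda>\<omega>. up_time X U n \<omega> + down_time X D n \<omega>"])
     (auto intro: trial_path.epoch_eq trial_path)

text \<open>
  Joint measurability in the sample point and time is what makes the time integral a random variable.
\<close>

lemma measurable_velocity:
  "(\<lambda>(\<omega>, u). velocity X U D c v u \<omega>) \<in> borel_measurable (M \<Otimes>\<^sub>M lborel)"
proof -
  have count: "(\<lambda>z. epoch_count X U D (snd z) (fst z)) \<in> measurable (M \<Otimes>\<^sub>M lborel) (count_space UNIV)"
    unfolding epoch_count_def by measurable
  have "(\<lambda>z. velocity_step X c v n (fst z)) \<in> borel_measurable (M \<Otimes>\<^sub>M lborel)" for n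
    unfolding velocity_step_def by measurable
  from measurable_compose_countable[OF this count] show ?thesis
    by (simp add: velocity_def case_prod_beta)
qed

lemma measurable_velocity_at [measurable]: "velocity X U D c v u \<in> borel_measurable M"
  using measurable_compose[OF measurable_Pair2' measurable_velocity, of u] by simp

lemma measurable_position [measurable]: "position X U D c v t \<in> borel_measurable M"
proof -
  have "(\<lambda>z. indicator {0..t} (snd z) *\<^sub>R (\<lambda>(\<omega>, u). velocity X U D c v u \<omega>) z) \<in> borel_measurable (M \<Otimes>\<^sub>M lborel)"
    using measurable_velocity by measurable
  then show ?thesis
    unfolding position_def[abs_def] set_lebesgue_integral_def
    by (intro lborel.borel_measurable_lebesgue_integral) (simp add: case_prod_beta)
qed

end

section \<open>The probability that a given step crosses\<close>

locale yule_telegraph = bernoulli_scheme M p X U D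
  for M :: "'a measure" and p X U D +
  fixes lam \<mu> :: real
  assumes rates_pos: "0 < lam" "0 < \<mu>"
    and p_bounds: "0 < p" "p < 1"
    and U_exp: "\<And>k. 1 \<le> k \<Longrightarrow> distributed M lborel (U k) (exponential_density (lam * real k))"
    and D_exp: "\<And>k. 1 \<le> k \<Longrightarrow> distributed M lborel (D k) (exponential_density (\<mu> * real k))"
begin

text \<open>
  \<open>U\<close> and \<open>D\<close> are subfamilies of the independent family indexed by a sum type; they are recovered
  by restricting the family to singleton blocks of indices.
\<close>

lemma indep_durations: "indep_vars (\<lambda>_. borel) U {1..}" "indep_vars (\<lambda>_. borel) D {1..}"
proof -
  define Z where "Z = case_sum (\<lambda>n \<omega>. real (X n \<omega>)) (case_sum U D)"
  have *: "indep_vars (\<lambda>_. borel) (\<lambda>k \<omega>. Z (g k) \<omega>) {1..}"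
    if g: "inj_on g {1..}" "g ` {1..} \<subseteq> {1..} <+> ({1..} <+> {1..})" for g :: "nat \<Rightarrow> nat + nat + nat"
  proof -
    have "indep_vars (\<lambda>k. Pi\<^sub>M {g k} (\<lambda>_. borel)) (\<lambda>k \<omega>. restrict (\<lambda>i. Z i \<omega>) {g k}) {1..}"
      using g by (intro indep_vars_restrict[OF independent[folded Z_def]])
        (auto simp: disjoint_family_on_def inj_on_def)
    from indep_vars_compose2[OF this, of "\<lambda>k f. f (g k)" "\<lambda>_. borel"]
    show ?thesis by simp
  qed
  have "indep_vars (\<lambda>_. borel) (\<lambda>k \<omega>. Z (Inr (Inl k)) \<omega>) {1..}"
    by (rule *) (auto simp: inj_on_def)
  then show "indep_vars (\<lambda>_. borel) U {1..}" by (simp add: Z_def)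
  have "indep_vars (\<lambda>_. borel) (\<lambda>k \<omega>. Z (Inr (Inr k)) \<omega>) {1..}"
    by (rule *) (auto simp: inj_on_def)
  then show "indep_vars (\<lambda>_. borel) D {1..}" by (simp add: Z_def)
qed

lemma AE_durations_pos: "AE \<omega> in M. \<forall>k\<ge>1. 0 < U k \<omega> \<and> 0 < D k \<omega>"
proof -
  have "AE \<omega> in M. 1 \<le> k \<longrightarrow> 0 < U k \<omega> \<and> 0 < D k \<omega>" for k
    using rates_pos AE_exponential_pos[OF U_exp[of k]] AE_exponential_pos[OF D_exp[of k]]
    by (cases "1 \<le> k") auto
  then show ?thesis by (simp add: AE_all_countable)
qed

lemma AE_path: "AE \<omega> in M. telegraph_path X U D \<omega>"
  using AE_durations_pos AE_space
  by eventually_elim (auto simp: telegraph_path_def telegraph_path_axioms_def less_imp_le intro: trial_path)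

text \<open>
  The independent family is split into blocks: each of the first \<open>N\<close> trials on its own, all
  durations \<open>U\<close>, and all durations \<open>D\<close>. The event is an intersection of one event per block.
\<close>

lemma prob_word_and_durations:
  assumes w: "\<And>i. i \<in> {1..N} \<Longrightarrow> w i \<in> {0, 1}"
  shows "\<P>(\<omega> in M. (\<forall>i\<in>{1..N}. X i \<omega> = w i)
            \<and> ((\<Sum>k=1..j. U k \<omega>) \<le> a \<and> a < (\<Sum>k=1..Suc j. U k \<omega>)) \<and> (\<Sum>k=1..m. D k \<omega>) < d)
       = (\<Prod>i=1..N. if w i = 1 then p else 1 - p)
          * \<P>(\<omega> in M. (\<Sum>k=1..j. U k \<omega>) \<le> a \<and> a < (\<Sum>k=1..Suc j. U k \<omega>))
          * \<P>(\<omega> in M. (\<Sum>k=1..m. D k \<omega>) < d)"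
proof -
  define Z where "Z = case_sum (\<lambda>n \<omega>. real (X n \<omega>)) (case_sum U D)"
  define I :: "(nat + nat + nat) set" where "I = {1..} <+> ({1..} <+> {1..})"
  define L :: "(nat + bool) set" where "L = {1..N} <+> UNIV"
  define K :: "nat + bool \<Rightarrow> (nat + nat + nat) set" where
    "K = case_sum (\<lambda>i. {Inl i}) (\<lambda>b. if b then (Inr \<circ> Inl) ` {1..} else (Inr \<circ> Inr) ` {1..})"
  define Y :: "nat + bool \<Rightarrow> (nat + nat + nat \<Rightarrow> real) \<Rightarrow> bool" where
    "Y = case_sum (\<lambda>i f. f (Inl i) = real (w i))
       (\<lambda>b f. if b then (\<Sum>k=1..j. f (Inr (Inl k))) \<le> a \<and> a < (\<Sum>k=1..Suc j. f (Inr (Inl k)))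
             else (\<Sum>k=1..m. f (Inr (Inr k))) < d)"
  define R where "R = (\<lambda>l \<omega>. restrict (\<lambda>i. Z i \<omega>) (K l))"
  have ind: "indep_vars (\<lambda>l. Pi\<^sub>M (K l) (\<lambda>_. borel)) R L"
    unfolding R_def
  proof (rule indep_vars_restrict)
    show "indep_vars (\<lambda>_. borel) Z I" using independent by (simp add: Z_def I_def)
    show "K l \<subseteq> I" if "l \<in> L" for l
      using that by (auto simp: K_def I_def L_def split: if_splits)
    show "disjoint_family_on K L"
      by (auto simp: disjoint_family_on_def K_def L_def split: if_splits)
  qed
  have meas: "Y l \<in> measurable (Pi\<^sub>M (K l) (\<lambda>_. borel)) (count_space UNIV)" if "l \<in> L" for l
  proof -
    have up: "(\<lambda>f. \<Sum>k=1..j. f (Inr (Inl k))) \<in> borel_measurable (Pi\<^sub>M (K (Inr True)) (\<lambda>_. borel :: real measure))"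
      for j
      by (intro borel_measurable_sum measurable_component_singleton) (auto simp: K_def)
    have down: "(\<lambda>f. \<Sum>k=1..m. f (Inr (Inr k))) \<in> borel_measurable (Pi\<^sub>M (K (Inr False)) (\<lambda>_. borel :: real measure))"
      by (intro borel_measurable_sum measurable_component_singleton) (auto simp: K_def)
    have letter: "(\<lambda>f. f (Inl i)) \<in> borel_measurable (Pi\<^sub>M (K (Inl i)) (\<lambda>_. borel :: real measure))" for i
      by (intro measurable_component_singleton) (auto simp: K_def)
    note [measurable] = up down letter
    show ?thesis
    proof (cases l)
      case (Inl i)
      have "(\<lambda>f. f (Inl i) = real (w i)) \<in> measurable (Pi\<^sub>M (K (Inl i)) (\<lambda>_. borel)) (count_space UNIV)"
        by measurable
      then show ?thesis by (simp add: Inl Y_def)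
    next
      case (Inr b)
      have "(\<lambda>f. (\<Sum>k=1..j. f (Inr (Inl k))) \<le> a \<and> a < (\<Sum>k=1..Suc j. f (Inr (Inl k))))
          \<in> measurable (Pi\<^sub>M (K (Inr True)) (\<lambda>_. borel)) (count_space UNIV)"
        using up[of j] up[of "Suc j"] by measurable
      moreover have "(\<lambda>f. (\<Sum>k=1..m. f (Inr (Inr k))) < d)
          \<in> measurable (Pi\<^sub>M (K (Inr False)) (\<lambda>_. borel)) (count_space UNIV)"
        by measurable
      ultimately show ?thesis by (cases b) (simp_all add: Inr Y_def)
    qed
  qed
  have R_Inl: "Y (Inl i) (R (Inl i) \<omega>) \<longleftrightarrow> X i \<omega> = w i" for i \<omega>
    by (simp add: Y_def R_def K_def Z_def)
  have R_up: "(\<Sum>k=1..j. R (Inr True) \<omega> (Inr (Inl k))) = (\<Sum>k=1..j. U k \<omega>)" for j \<omega>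
    by (intro sum.cong) (auto simp: R_def K_def Z_def)
  have R_down: "(\<Sum>k=1..m. R (Inr False) \<omega> (Inr (Inr k))) = (\<Sum>k=1..m. D k \<omega>)" for \<omega>
    by (intro sum.cong) (auto simp: R_def K_def Z_def)
  have R_True: "Y (Inr True) (R (Inr True) \<omega>) \<longleftrightarrow>
      (\<Sum>k=1..j. U k \<omega>) \<le> a \<and> a < (\<Sum>k=1..Suc j. U k \<omega>)" for \<omega>
    unfolding Y_def by (simp only: sum.case if_True R_up)
  have R_False: "Y (Inr False) (R (Inr False) \<omega>) \<longleftrightarrow> (\<Sum>k=1..m. D k \<omega>) < d" for \<omega>
    unfolding Y_def by (simp only: sum.case if_False R_down)
  have "prob (\<Inter>l\<in>L. (\<lambda>\<omega>. Y l (R l \<omega>)) -` {True} \<inter> space M)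
      = (\<Prod>l\<in>L. prob ((\<lambda>\<omega>. Y l (R l \<omega>)) -` {True} \<inter> space M))"
    by (rule indep_varsD_finite[OF indep_vars_compose2[OF ind meas]]) (auto simp: L_def)
  moreover have "(\<Inter>l\<in>L. (\<lambda>\<omega>. Y l (R l \<omega>)) -` {True} \<inter> space M)
      = {\<omega>\<in>space M. (\<forall>i\<in>{1..N}. Y (Inl i) (R (Inl i) \<omega>)) \<and> Y (Inr True) (R (Inr True) \<omega>)
           \<and> Y (Inr False) (R (Inr False) \<omega>)}"
    unfolding L_def by (force simp: UNIV_bool)
  moreover have "(\<Prod>l\<in>L. prob ((\<lambda>\<omega>. Y l (R l \<omega>)) -` {True} \<inter> space M))
      = (\<Prod>i=1..N. \<P>(\<omega> in M. Y (Inl i) (R (Inl i) \<omega>)))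
        * (\<P>(\<omega> in M. Y (Inr True) (R (Inr True) \<omega>)) * \<P>(\<omega> in M. Y (Inr False) (R (Inr False) \<omega>)))"
    unfolding L_def by (subst prod.Plus) (auto simp: UNIV_bool vimage_def Int_def conj_commute)
  moreover have "(\<Prod>i=1..N. \<P>(\<omega> in M. X i \<omega> = w i)) = (\<Prod>i=1..N. if w i = 1 then p else 1 - p)"
    using w trial_one trial_zero by (intro prod.cong) fastforce+
  ultimately show ?thesis by (simp only: mult.assoc R_Inl R_True R_False)
qed

text \<open>
  Decompose according to the word formed by the first \<open>n\<close> trials. For a fixed word with \<open>j\<close> successes
  the crossing only involves sums of fixed numbers of durations, and its probability is
  \<open>p \<theta>\<close> times a product of one factor per letter; summing a product over all words gives the product
  of the sums. The sets \<open>B i\<close> allow a trial to be prescribed.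
\<close>

lemma prob_crossing:
  assumes a: "0 \<le> a" and d: "0 < d" and B: "\<And>i. B i \<subseteq> {0, 1}"
  defines "\<theta> \<equiv> exp (- lam * a)" and "q \<equiv> 1 - exp (- \<mu> * d)"
  shows "\<P>(\<omega> in M. (\<forall>i\<in>{1..n}. X i \<omega> \<in> B i) \<and> crossing X U D a d n \<omega>)
    = p * \<theta> * (\<Prod>i=1..n. \<Sum>e\<in>B i. if e = 1 then p * (1 - \<theta>) else (1 - p) * q)"
proof -
  have finB: "finite (B i)" for i using B[of i] by (rule finite_subset) simp
  define W where "W = Pi\<^sub>E {1..n} B"
  have finW: "finite W" unfolding W_def by (intro finite_PiE finB) auto
  have W: "w i = 0 \<or> w i = 1" if "w \<in> W" "i \<in> {1..n}" for w i
    using that B[of i] by (auto simp: W_def PiE_iff)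
  define E where "E = (\<lambda>w. {\<omega>\<in>space M. (\<forall>i\<in>{1..n}. X i \<omega> = w i) \<and> crossing X U D a d n \<omega>})"
  have "{\<omega>\<in>space M. (\<forall>i\<in>{1..n}. X i \<omega> \<in> B i) \<and> crossing X U D a d n \<omega>} = (\<Union>w\<in>W. E w)"
  proof (intro equalityI subsetI)
    fix \<omega> assume "\<omega> \<in> {\<omega>\<in>space M. (\<forall>i\<in>{1..n}. X i \<omega> \<in> B i) \<and> crossing X U D a d n \<omega>}"
    then have "restrict (\<lambda>i. X i \<omega>) {1..n} \<in> W" "\<omega> \<in> E (restrict (\<lambda>i. X i \<omega>) {1..n})"
      by (auto simp: W_def E_def)
    then show "\<omega> \<in> (\<Union>w\<in>W. E w)" by blast
  qed (auto simp: W_def E_def PiE_iff)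
  moreover have "prob (\<Union>w\<in>W. E w) = (\<Sum>w\<in>W. prob (E w))"
  proof (rule finite_measure_finite_Union[OF finW])
    show "E ` W \<subseteq> events" unfolding E_def by (auto intro!: sets.sets_Collect measurable_trial)
    show "disjoint_family_on E W"
      unfolding disjoint_family_on_def
    proof (intro ballI impI)
      fix w w' assume w: "w \<in> W" "w' \<in> W" "w \<noteq> w'"
      then obtain i where "i \<in> {1..n}" "w i \<noteq> w' i"
        unfolding W_def by (meson PiE_ext)
      then show "E w \<inter> E w' = {}" by (auto simp: E_def)
    qed
  qed
  moreover have "prob (E w) = p * \<theta> * (\<Prod>i=1..n. if w i = 1 then p * (1 - \<theta>) else (1 - p) * q)"
    if w: "w \<in> W" for w
  proof -
    define j where "j = (\<Sum>i=1..n. w i)"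
    \<comment> \<open>a crossing step is a success, so the word of length \<open>n + 1\<close> is determined\<close>
    define w' where "w' = w(Suc n := 1)"
    have diff: "n - j = (\<Sum>i=1..n. 1 - w i)"
      unfolding j_def using W[OF w] by (subst sum_subtractf_nat) force+
    have "E w = {\<omega>\<in>space M. (\<forall>i\<in>{1..Suc n}. X i \<omega> = w' i)
            \<and> ((\<Sum>k=1..j. U k \<omega>) \<le> a \<and> a < (\<Sum>k=1..Suc j. U k \<omega>)) \<and> (\<Sum>k=1..n-j. D k \<omega>) < d}"
    proof -
      have *: "(\<forall>i\<in>{1..Suc n}. X i \<omega> = w' i) \<longleftrightarrow> (\<forall>i\<in>{1..n}. X i \<omega> = w i) \<and> X (Suc n) \<omega> = 1" for \<omega>
        by (auto simp: w'_def le_Suc_eq)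
      have "ones X n \<omega> = j" if "\<forall>i\<in>{1..n}. X i \<omega> = w i" for \<omega>
        unfolding ones_def j_def using that by (intro sum.cong) auto
      then show "E w = {\<omega>\<in>space M. (\<forall>i\<in>{1..Suc n}. X i \<omega> = w' i)
            \<and> ((\<Sum>k=1..j. U k \<omega>) \<le> a \<and> a < (\<Sum>k=1..Suc j. U k \<omega>)) \<and> (\<Sum>k=1..n-j. D k \<omega>) < d}"
        unfolding E_def * crossing_def up_time_def down_time_def by (auto simp: ones_Suc)
    qed
    moreover have "w' i \<in> {0, 1}" if "i \<in> {1..Suc n}" for i
      using that W[OF w, of i] by (auto simp: w'_def le_Suc_eq)
    ultimately have "prob (E w) = (\<Prod>i=1..Suc n. if w' i = 1 then p else 1 - p) * (\<theta> * (1 - \<theta>) ^ j) * q ^ (n - j)"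
      unfolding \<theta>_def q_def
      by (simp only: prob_word_and_durations
            prob_sum_exponential_between[OF indep_durations(1) rates_pos(1) U_exp a]
            prob_sum_exponential_less[OF indep_durations(2) rates_pos(2) D_exp d])
    also have "(\<Prod>i=1..Suc n. if w' i = 1 then p else 1 - p) = p * (\<Prod>i=1..n. if w i = 1 then p else 1 - p)"
      by (simp add: w'_def)
    also have "p * (\<Prod>i=1..n. if w i = 1 then p else 1 - p) * (\<theta> * (1 - \<theta>) ^ j) * q ^ (n - j)
       = p * \<theta> * ((\<Prod>i=1..n. if w i = 1 then p else 1 - p) * (\<Prod>i=1..n. (1 - \<theta>) ^ w i) * (\<Prod>i=1..n. q ^ (1 - w i)))"
      unfolding diff unfolding j_def power_sum by (simp only: mult_ac)
    also have "\<dots> = p * \<theta> * (\<Prod>i=1..n. if w i = 1 then p * (1 - \<theta>) else (1 - p) * q)"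
      unfolding prod.distrib[symmetric] using W[OF w] by (intro arg_cong[where f="(*) (p * \<theta>)"] prod.cong) force+
    finally show ?thesis .
  qed
  ultimately have "\<P>(\<omega> in M. (\<forall>i\<in>{1..n}. X i \<omega> \<in> B i) \<and> crossing X U D a d n \<omega>)
      = p * \<theta> * (\<Sum>w\<in>W. \<Prod>i=1..n. if w i = 1 then p * (1 - \<theta>) else (1 - p) * q)"
    by (simp add: sum_distrib_left)
  then show ?thesis
    unfolding W_def by (subst prod_sum_PiE) (auto simp: finB)
qed

section \<open>The first trial and the crossing\<close>

text \<open>
  A monotone staircase passes a vertical line only once. It is monotone almost surely, so the
  crossing events are first cut down to the event \<open>G\<close> of positive durations, on which they are disjoint.
\<close>

lemma sums_prob_crossing:
  assumes "Measurable.pred M Q"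
  shows "(\<lambda>n. \<P>(\<omega> in M. Q \<omega> \<and> crossing X U D a d n \<omega>)) sums \<P>(\<omega> in M. Q \<omega> \<and> (\<exists>n. crossing X U D a d n \<omega>))"
proof -
  note [measurable] = assms
  define G where "G = (\<lambda>\<omega>. \<forall>k\<ge>1. 0 < U k \<omega> \<and> 0 < D k \<omega>)"
  have [measurable]: "Measurable.pred M G"
    unfolding G_def by measurable
  have G: "AE \<omega> in M. G \<omega>" unfolding G_def by (rule AE_durations_pos)
  define A where "A = (\<lambda>n. {\<omega>\<in>space M. G \<omega> \<and> Q \<omega> \<and> crossing X U D a d n \<omega>})"
  have "disjoint_family A"
    unfolding disjoint_family_on_def
  proof (intro ballI impI)
    have *: False if mn: "m < n" and \<omega>: "\<omega> \<in> A m" "\<omega> \<in> A n" for m n \<omega>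
    proof -
      interpret telegraph_path X U D \<omega>
        using \<omega> by (auto simp: telegraph_path_def telegraph_path_axioms_def A_def G_def less_imp_le intro: trial_path)
      show False
        using \<omega> up_time_mono[of "Suc m" n] mn by (auto simp: A_def crossing_def)
    qed
    show "A m \<inter> A n = {}" if "m \<noteq> n" for m n
      using *[of m n] *[of n m] that by (cases m n rule: linorder_cases) auto
  qed
  moreover have "range A \<subseteq> events" unfolding A_def by auto
  ultimately have "(\<lambda>n. prob (A n)) sums prob (\<Union>n. A n)"
    by (intro finite_measure_UNION)
  moreover have "prob (A n) = \<P>(\<omega> in M. Q \<omega> \<and> crossing X U D a d n \<omega>)" for n
    unfolding A_def using G by (intro prob_eq_AE) auto
  moreover have "(\<Union>n. A n) = {\<omega>\<in>space M. G \<omega> \<and> Q \<omega> \<and> (\<exists>n. crossing X U D a d n \<omega>)}"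
    by (auto simp: A_def)
  moreover have "prob {\<omega>\<in>space M. G \<omega> \<and> Q \<omega> \<and> (\<exists>n. crossing X U D a d n \<omega>)}
      = \<P>(\<omega> in M. Q \<omega> \<and> (\<exists>n. crossing X U D a d n \<omega>))"
    using G by (intro prob_eq_AE) auto
  ultimately show ?thesis by simp
qed

lemma prob_first_letter_crossing_Suc:
  assumes a: "0 \<le> a" and d: "0 < d" and e: "e \<in> {0, 1}"
  defines "\<theta> \<equiv> exp (- lam * a)" and "q \<equiv> 1 - exp (- \<mu> * d)"
  shows "\<P>(\<omega> in M. X 1 \<omega> = e \<and> crossing X U D a d (Suc n) \<omega>)
    = p * \<theta> * (if e = 1 then p * (1 - \<theta>) else (1 - p) * q) * (p * (1 - \<theta>) + (1 - p) * q) ^ n"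
proof -
  define B :: "nat \<Rightarrow> nat set" where "B = (\<lambda>i. if i = 1 then {e} else {0, 1})"
  define g where "g = (\<lambda>i. \<Sum>e\<in>B i. if e = 1 then p * (1 - \<theta>) else (1 - p) * q)"
  have "\<P>(\<omega> in M. X 1 \<omega> = e \<and> crossing X U D a d (Suc n) \<omega>)
      = \<P>(\<omega> in M. (\<forall>i\<in>{1..Suc n}. X i \<omega> \<in> B i) \<and> crossing X U D a d (Suc n) \<omega>)"
  proof (intro arg_cong[where f=prob] Collect_cong conj_cong refl)
    show "X 1 \<omega> = e \<longleftrightarrow> (\<forall>i\<in>{1..Suc n}. X i \<omega> \<in> B i)" if "\<omega> \<in> space M" for \<omega>
      using trial_path.letter[OF trial_path[OF that]] by (force simp: B_def)
  qed
  also have "\<dots> = p * \<theta> * prod g {1..Suc n}"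
    unfolding \<theta>_def q_def g_def using e by (intro prob_crossing a d) (auto simp: B_def)
  also have "prod g {1..Suc n} = g 1 * prod g {Suc 1..Suc n}"
    by (intro prod.atLeast_Suc_atMost) simp
  also have "prod g {Suc 1..Suc n} = (\<Prod>i\<in>{Suc 1..Suc n}. p * (1 - \<theta>) + (1 - p) * q)"
    by (intro prod.cong) (auto simp: g_def B_def)
  finally show ?thesis by (simp add: g_def B_def mult.assoc)
qed

text \<open>
  The geometric series over the crossing step. Crossing at the very first step forces the first trial
  to be a success, which accounts for the additional term \<open>p \<theta>\<close> in the first formula only.
\<close>

lemma prob_first_letter_crossing:
  assumes a: "0 \<le> a" and d: "0 < d"
  defines "\<theta> \<equiv> exp (- lam * a)" and "\<eta> \<equiv> exp (- \<mu> * d)"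
  shows "\<P>(\<omega> in M. X 1 \<omega> = 1 \<and> (\<exists>n. crossing X U D a d n \<omega>))
           = p * \<theta> * (p + (1 - p) * \<eta>) / (p * \<theta> + (1 - p) * \<eta>)" (is ?up)
    and "\<P>(\<omega> in M. X 1 \<omega> = 0 \<and> (\<exists>n. crossing X U D a d n \<omega>))
           = p * \<theta> * ((1 - p) * (1 - \<eta>)) / (p * \<theta> + (1 - p) * \<eta>)" (is ?down)
proof -
  define \<rho> where "\<rho> = p * (1 - \<theta>) + (1 - p) * (1 - \<eta>)"
  have \<theta>: "0 < \<theta>" "\<theta> \<le> 1" and \<eta>: "0 < \<eta>" "\<eta> \<le> 1"
    using rates_pos a d by (auto simp: \<theta>_def \<eta>_def)
  have den: "1 - \<rho> = p * \<theta> + (1 - p) * \<eta>" by (simp add: \<rho>_def algebra_simps)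
  have "0 < p * \<theta> + (1 - p) * \<eta>" using p_bounds \<theta> \<eta> by (intro add_pos_pos) auto
  moreover have "0 \<le> \<rho>" unfolding \<rho>_def using p_bounds \<theta> \<eta> by simp
  ultimately have \<rho>: "\<bar>\<rho>\<bar> < 1" using den by simp
  have sum: "\<P>(\<omega> in M. X 1 \<omega> = e \<and> (\<exists>n. crossing X U D a d n \<omega>))
     = \<P>(\<omega> in M. X 1 \<omega> = e \<and> crossing X U D a d 0 \<omega>)
       + p * \<theta> * (if e = 1 then p * (1 - \<theta>) else (1 - p) * (1 - \<eta>)) / (1 - \<rho>)" if e: "e \<in> {0, 1}" for e
  proof -
    let ?P = "\<lambda>n. \<P>(\<omega> in M. X 1 \<omega> = e \<and> crossing X U D a d n \<omega>)"
    let ?C = "p * \<theta> * (if e = 1 then p * (1 - \<theta>) else (1 - p) * (1 - \<eta>))"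
    have "(\<lambda>n. ?C * \<rho> ^ n) sums (?C * (1 / (1 - \<rho>)))"
      using \<rho> by (intro sums_mult geometric_sums) simp
    also have "(\<lambda>n. ?C * \<rho> ^ n) = (\<lambda>n. ?P (Suc n))"
      unfolding prob_first_letter_crossing_Suc[OF a d e] \<rho>_def \<theta>_def \<eta>_def by simp
    finally have "?P sums (?C * (1 / (1 - \<rho>)) + ?P 0)" by (rule sums_Suc)
    from sums_unique2[OF sums_prob_crossing this] show ?thesis
      by (simp add: measurable_trial)
  qed
  have "\<P>(\<omega> in M. X 1 \<omega> = 1 \<and> crossing X U D a d 0 \<omega>) = \<P>(\<omega> in M. (\<forall>i\<in>{1..0}. X i \<omega> \<in> {0, 1}) \<and> crossing X U D a d 0 \<omega>)"
    by (intro arg_cong[where f=prob]) (auto simp: crossing_def)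
  also have "\<dots> = p * \<theta>"
    unfolding \<theta>_def using prob_crossing[OF a d, of "\<lambda>_. {0, 1}" 0] by simp
  finally have "\<P>(\<omega> in M. X 1 \<omega> = 1 \<and> (\<exists>n. crossing X U D a d n \<omega>)) = p * \<theta> + p * \<theta> * (p * (1 - \<theta>)) / (1 - \<rho>)"
    using sum[of 1] by simp
  also have "\<dots> = p * \<theta> * (1 - \<rho> + p * (1 - \<theta>)) / (1 - \<rho>)"
    using \<rho> by (simp add: field_simps)
  also have "1 - \<rho> + p * (1 - \<theta>) = p + (1 - p) * \<eta>"
    by (simp add: \<rho>_def algebra_simps)
  finally show ?up unfolding den .
  have "\<P>(\<omega> in M. X 1 \<omega> = 0 \<and> crossing X U D a d 0 \<omega>) = prob {}"
    by (intro arg_cong[where f=prob]) (auto simp: crossing_def)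
  then show ?down
    using sum[of 0] unfolding den by simp
qed

section \<open>The distribution functions of the position\<close>

text \<open>
  Among any \<open>m + n\<close> trials there are at least \<open>m\<close> successes or at least \<open>n\<close> failures. Hence the
  epochs are unbounded for every sequence of trials once both series of durations diverge.
\<close>

lemma AE_epoch_unbounded: "AE \<omega> in M. \<exists>n. t < epoch X U D n \<omega>"
proof -
  have "AE \<omega> in M. \<exists>n. t < (\<Sum>k=1..n. U k \<omega>)"
    by (rule AE_sum_exponential_unbounded[OF indep_durations(1) rates_pos(1)]) (rule U_exp)
  moreover have "AE \<omega> in M. \<exists>n. t < (\<Sum>k=1..n. D k \<omega>)"
    by (rule AE_sum_exponential_unbounded[OF indep_durations(2) rates_pos(2)]) (rule D_exp)
  ultimately show ?thesis
    using AE_path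
  proof eventually_elim
    case (elim \<omega>)
    interpret telegraph_path X U D \<omega> by fact
    obtain m n where m: "t < (\<Sum>k=1..m. U k \<omega>)" and n: "t < (\<Sum>k=1..n. D k \<omega>)"
      using elim by blast
    have "m \<le> ones X (m + n) \<omega> \<or> n \<le> m + n - ones X (m + n) \<omega>" by linarith
    then have "(\<Sum>k=1..m. U k \<omega>) \<le> up_time X U (m + n) \<omega> \<or> (\<Sum>k=1..n. D k \<omega>) \<le> down_time X D (m + n) \<omega>"
      unfolding up_time_def down_time_def
      by (auto intro!: sum_mono2 up_nonneg down_nonneg)
    moreover have "0 \<le> up_time X U (m + n) \<omega>" "0 \<le> down_time X D (m + n) \<omega>"
      using up_time_mono[of 0 "m + n"] down_time_mono[of 0 "m + n"] by auto
    ultimately have "t < epoch X U D (m + n) \<omega>"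
      using m n unfolding epoch_eq by linarith
    then show ?case by blast
  qed
qed

text \<open>
  Time 0 belongs to the first period only if that period has positive length, which is almost sure.
\<close>

lemma AE_initial_velocity: "AE \<omega> in M. velocity X U D c v 0 \<omega> = (if X 1 \<omega> = 1 then c else - v)"
  using AE_path AE_durations_pos
proof eventually_elim
  case (elim \<omega>)
  interpret telegraph_path X U D \<omega> by fact
  have "0 < epoch X U D (Suc 0) \<omega>"
    using elim unfolding epoch_eq by (auto simp: up_time_Suc down_time_Suc)
  then show ?case
    using velocity_eq[of 0 0 c v] by (simp add: velocity_step_def del: epoch.simps(2))
qed

context
  fixes c v t y \<tau> :: real
  assumes vel: "0 < c" "0 < v" and t: "0 < t" and y: "- v * t < y" "y < c * t"
    and \<tau>: "\<tau> = (v * t + y) / (c + v)"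
begin

text \<open>
  Translation of the event into the staircase picture: position \<open>y\<close> corresponds to up-time \<open>\<tau>\<close>, and
  the initial velocity to the first trial, with \<open>e = 1\<close> for \<open>c\<close> and \<open>e = 0\<close> for \<open>- v\<close>.
\<close>

lemma position_cdf_first_letter:
  assumes e: "e \<in> {0, 1}"
  shows "\<P>(\<omega> in M. position X U D c v t \<omega> \<le> y \<and> velocity X U D c v 0 \<omega> = (if e = 1 then c else - v))
    = (if e = 1 then p else 1 - p) - \<P>(\<omega> in M. X 1 \<omega> = e \<and> (\<exists>n. crossing X U D \<tau> (t - \<tau>) n \<omega>))"
proof -
  have "0 \<le> \<tau>" using vel y by (simp add: \<tau>)
  have y_eq: "(c + v) * \<tau> - v * t = y" using vel by (simp add: \<tau>)
  let ?c = "\<lambda>\<omega>. \<exists>n. crossing X U D \<tau> (t - \<tau>) n \<omega>"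
  have "AE \<omega> in M. position X U D c v t \<omega> \<le> y \<and> velocity X U D c v 0 \<omega> = (if e = 1 then c else - v)
      \<longleftrightarrow> X 1 \<omega> = e \<and> \<not> ?c \<omega>"
    using AE_epoch_unbounded[of t] AE_path AE_initial_velocity[of c v]
  proof eventually_elim
    case (elim \<omega>)
    interpret telegraph_path X U D \<omega> by fact
    from elim obtain N where "t < epoch X U D N \<omega>" by blast
    from position_gt_iff_crossing[OF vel t \<open>0 \<le> \<tau>\<close> this]
    show ?case
      using elim vel e letter[of 1] by (auto simp: y_eq not_less[symmetric])
  qed
  then have "\<P>(\<omega> in M. position X U D c v t \<omega> \<le> y \<and> velocity X U D c v 0 \<omega> = (if e = 1 then c else - v))
      = \<P>(\<omega> in M. X 1 \<omega> = e \<and> \<not> ?c \<omega>)"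
    by (intro prob_eq_AE) (auto intro: measurable_trial)
  also have "\<dots> = prob ({\<omega>\<in>space M. X 1 \<omega> = e} - {\<omega>\<in>space M. X 1 \<omega> = e \<and> ?c \<omega>})"
    by (intro arg_cong[where f=prob]) auto
  also have "\<dots> = \<P>(\<omega> in M. X 1 \<omega> = e) - \<P>(\<omega> in M. X 1 \<omega> = e \<and> ?c \<omega>)"
    by (intro finite_measure_Diff) auto
  also have "\<P>(\<omega> in M. X 1 \<omega> = e) = (if e = 1 then p else 1 - p)"
    using e trial_one[of 1] trial_zero[of 1] by auto
  finally show ?thesis .
qed

text \<open>
  The crossing probabilities are fractions in \<open>\<theta> = exp (- lam \<tau>) = 1 / L\<close> and
  \<open>\<eta> = exp (- \<mu> (t - \<tau>)) = H / T\<close>, where \<open>L = exp (lam \<tau>)\<close>, \<open>H = exp (\<mu> \<tau>)\<close> and \<open>T = exp (\<mu> t)\<close>.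
  Extending them by \<open>L T\<close> yields the common denominator \<open>N = p T + (1 - p) L H\<close>.
\<close>

lemma position_cdf_joint:
  shows position_cdf_up: "\<P>(\<omega> in M. position X U D c v t \<omega> \<le> y \<and> velocity X U D c v 0 \<omega> = c)
      = p * ((1 - p) * (exp ((lam + \<mu>) * \<tau>) - exp (\<mu> * \<tau>))
          / (p * exp (\<mu> * t) + (1 - p) * exp ((lam + \<mu>) * \<tau>)))"
    and position_cdf_down: "\<P>(\<omega> in M. position X U D c v t \<omega> \<le> y \<and> velocity X U D c v 0 \<omega> = - v)
      = (1 - p) * (((1 - p) * exp ((lam + \<mu>) * \<tau>) + p * exp (\<mu> * \<tau>))
          / (p * exp (\<mu> * t) + (1 - p) * exp ((lam + \<mu>) * \<tau>)))"
proof -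
  have \<tau>_bounds: "0 \<le> \<tau>" "0 < t - \<tau>"
    using vel y by (simp_all add: \<tau> field_simps)
  define \<theta> where "\<theta> = exp (- lam * \<tau>)"
  define \<eta> where "\<eta> = exp (- \<mu> * (t - \<tau>))"
  define T where "T = exp (\<mu> * t)"
  define L where "L = exp (lam * \<tau>)"
  define H where "H = exp (\<mu> * \<tau>)"
  have pos: "0 < T" "0 < L" "0 < H" by (simp_all add: T_def L_def H_def)
  have \<theta>: "\<theta> = 1 / L" and \<eta>: "\<eta> = H / T" and LH: "exp ((lam + \<mu>) * \<tau>) = L * H"
    by (simp_all add: \<theta>_def \<eta>_def T_def L_def H_def exp_minus exp_diff exp_add algebra_simps inverse_eq_divide)
  define N where "N = p * T + (1 - p) * (L * H)"
  have "N > 0"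
    unfolding N_def using pos p_bounds by (intro add_pos_pos) auto
  have den: "p * \<theta> + (1 - p) * \<eta> = N / (L * T)"
    using pos by (simp add: \<theta> \<eta> N_def field_simps)
  have "p * \<theta> * (p + (1 - p) * \<eta>) = p * (p * T + (1 - p) * H) / (L * T)"
    using pos by (simp add: \<theta> \<eta> field_simps)
  then have "p * \<theta> * (p + (1 - p) * \<eta>) / (p * \<theta> + (1 - p) * \<eta>) = p * (p * T + (1 - p) * H) / N"
    unfolding den using pos by simp
  then have "\<P>(\<omega> in M. position X U D c v t \<omega> \<le> y \<and> velocity X U D c v 0 \<omega> = c)
      = p - p * (p * T + (1 - p) * H) / N"
    using position_cdf_first_letter[of 1] prob_first_letter_crossing(1)[OF \<tau>_bounds, folded \<theta>_def \<eta>_def]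
    by simp
  also have "\<dots> = p * ((N - (p * T + (1 - p) * H)) / N)"
    using \<open>N > 0\<close> by (simp add: field_simps)
  also have "N - (p * T + (1 - p) * H) = (1 - p) * (L * H - H)"
    by (simp add: N_def algebra_simps)
  finally show "\<P>(\<omega> in M. position X U D c v t \<omega> \<le> y \<and> velocity X U D c v 0 \<omega> = c)
      = p * ((1 - p) * (exp ((lam + \<mu>) * \<tau>) - exp (\<mu> * \<tau>))
          / (p * exp (\<mu> * t) + (1 - p) * exp ((lam + \<mu>) * \<tau>)))"
    unfolding LH N_def T_def H_def .
  have "p * \<theta> * ((1 - p) * (1 - \<eta>)) = p * ((1 - p) * (T - H)) / (L * T)"
    using pos by (simp add: \<theta> \<eta> field_simps)
  then have "p * \<theta> * ((1 - p) * (1 - \<eta>)) / (p * \<theta> + (1 - p) * \<eta>) = p * ((1 - p) * (T - H)) / N"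
    unfolding den using pos by simp
  then have "\<P>(\<omega> in M. position X U D c v t \<omega> \<le> y \<and> velocity X U D c v 0 \<omega> = - v)
      = (1 - p) - p * ((1 - p) * (T - H)) / N"
    using position_cdf_first_letter[of 0] prob_first_letter_crossing(2)[OF \<tau>_bounds, folded \<theta>_def \<eta>_def]
    by simp
  also have "\<dots> = (1 - p) * ((N - p * (T - H)) / N)"
    using \<open>N > 0\<close> by (simp add: field_simps)
  also have "N - p * (T - H) = (1 - p) * (L * H) + p * H"
    by (simp add: N_def algebra_simps)
  finally show "\<P>(\<omega> in M. position X U D c v t \<omega> \<le> y \<and> velocity X U D c v 0 \<omega> = - v)
      = (1 - p) * (((1 - p) * exp ((lam + \<mu>) * \<tau>) + p * exp (\<mu> * \<tau>))
          / (p * exp (\<mu> * t) + (1 - p) * exp ((lam + \<mu>) * \<tau>)))"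
    unfolding LH N_def T_def H_def .
qed

lemma position_cdf:
  "\<P>(\<omega> in M. position X U D c v t \<omega> \<le> y)
     = (1 - p) * exp ((lam + \<mu>) * \<tau>) / (p * exp (\<mu> * t) + (1 - p) * exp ((lam + \<mu>) * \<tau>))"
proof -
  have "\<P>(\<omega> in M. position X U D c v t \<omega> \<le> y)
      = prob ({\<omega>\<in>space M. position X U D c v t \<omega> \<le> y \<and> velocity X U D c v 0 \<omega> = c}
          \<union> {\<omega>\<in>space M. position X U D c v t \<omega> \<le> y \<and> velocity X U D c v 0 \<omega> = - v})"
    by (intro arg_cong[where f=prob]) (auto simp: velocity_def velocity_step_def)
  also have "\<dots> = \<P>(\<omega> in M. position X U D c v t \<omega> \<le> y \<and> velocity X U D c v 0 \<omega> = c)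
      + \<P>(\<omega> in M. position X U D c v t \<omega> \<le> y \<and> velocity X U D c v 0 \<omega> = - v)"
    using vel by (intro finite_measure_Union) auto
  finally show ?thesis
    unfolding position_cdf_joint by (simp add: add_divide_distrib[symmetric]) (simp add: algebra_simps)
qed

end

lemma prob_initial_velocity:
  assumes "0 < c" "0 < v"
  shows "\<P>(\<omega> in M. velocity X U D c v 0 \<omega> = c) = p"
    and "\<P>(\<omega> in M. velocity X U D c v 0 \<omega> = - v) = 1 - p"
proof -
  have "\<P>(\<omega> in M. velocity X U D c v 0 \<omega> = c) = \<P>(\<omega> in M. X 1 \<omega> = 1)"
    using AE_initial_velocity[of c v] assms by (intro prob_eq_AE) (auto intro: measurable_trial)
  then show "\<P>(\<omega> in M. velocity X U D c v 0 \<omega> = c) = p"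
    using trial_one[of 1] by simp
  have "AE \<omega> in M. velocity X U D c v 0 \<omega> = - v \<longleftrightarrow> X 1 \<omega> = 0"
    using AE_initial_velocity[of c v] AE_path
    by eventually_elim (use assms telegraph_path.axioms(1) trial_path.letter[of X _ 1] in force)
  then have "\<P>(\<omega> in M. velocity X U D c v 0 \<omega> = - v) = \<P>(\<omega> in M. X 1 \<omega> = 0)"
    by (intro prob_eq_AE) (auto intro: measurable_trial)
  then show "\<P>(\<omega> in M. velocity X U D c v 0 \<omega> = - v) = 1 - p"
    using trial_zero[of 1] by simp
qed

end

section \<open>Densities\<close>

text \<open>
  Derivatives of the three distribution functions with respect to the up-time. The constant \<open>T\<close>
  stands for \<open>exp (\<mu> t)\<close>.
\<close>

lemma has_real_derivative_cdf_quotients: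
  fixes lam \<mu> p T \<tau> :: real
  assumes p: "0 < p" "p < 1" and T: "0 < T"
  defines "N \<equiv> \<lambda>a. p * T + (1 - p) * exp ((lam + \<mu>) * a)"
  shows "((\<lambda>a. (1 - p) * (exp ((lam + \<mu>) * a) - exp (\<mu> * a)) / N a) has_real_derivative
      (1 - p) * (lam * (1 - p) * exp ((lam + 2 * \<mu>) * \<tau>)
        + p * (T * exp (\<mu> * \<tau>)) * ((lam + \<mu>) * exp (lam * \<tau>) - \<mu>)) / (N \<tau>)\<^sup>2) (at \<tau>)" (is ?up)
    and "((\<lambda>a. ((1 - p) * exp ((lam + \<mu>) * a) + p * exp (\<mu> * a)) / N a) has_real_derivative
      p * (T * exp (\<mu> * \<tau>) * ((lam + \<mu>) * exp (lam * \<tau>) * (1 - p) + \<mu> * p)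
        - lam * (1 - p) * exp ((lam + 2 * \<mu>) * \<tau>)) / (N \<tau>)\<^sup>2) (at \<tau>)" (is ?down)
    and "((\<lambda>a. (1 - p) * exp ((lam + \<mu>) * a) / N a) has_real_derivative
      p * T * (1 - p) * (lam + \<mu>) * exp ((lam + \<mu>) * \<tau>) / (N \<tau>)\<^sup>2) (at \<tau>)" (is ?both)
proof -
  have N: "N \<tau> > 0" unfolding N_def using p T by (intro add_pos_pos) auto
  have dN: "(N has_real_derivative (1 - p) * ((lam + \<mu>) * exp ((lam + \<mu>) * \<tau>))) (at \<tau>)"
    unfolding N_def by (auto intro!: derivative_eq_intros)
  have e1: "exp ((lam + \<mu>) * \<tau>) = exp (lam * \<tau>) * exp (\<mu> * \<tau>)"
    by (simp add: exp_add[symmetric] algebra_simps)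
  have e2: "exp ((lam + 2 * \<mu>) * \<tau>) = exp (lam * \<tau>) * (exp (\<mu> * \<tau>))\<^sup>2"
    by (simp add: exp_add[symmetric] power2_eq_square algebra_simps)
  have quot: "((\<lambda>a. f a / N a) has_real_derivative D / (N \<tau>)\<^sup>2) (at \<tau>)"
    if "(f has_real_derivative f') (at \<tau>)"
      and "f' * N \<tau> - (1 - p) * ((lam + \<mu>) * exp ((lam + \<mu>) * \<tau>)) * f \<tau> = D" for f f' D
    using DERIV_quotient[OF that(1) dN] N that(2) by (simp add: numeral_2_eq_2)
  have d_up: "((\<lambda>a. (1 - p) * (exp ((lam + \<mu>) * a) - exp (\<mu> * a))) has_real_derivative
      (1 - p) * ((lam + \<mu>) * exp ((lam + \<mu>) * \<tau>) - \<mu> * exp (\<mu> * \<tau>))) (at \<tau>)"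
    by (auto intro!: derivative_eq_intros)
  show ?up
    by (rule quot[OF d_up]) (unfold N_def e1 e2, algebra)
  have d_down: "((\<lambda>a. (1 - p) * exp ((lam + \<mu>) * a) + p * exp (\<mu> * a)) has_real_derivative
      (1 - p) * ((lam + \<mu>) * exp ((lam + \<mu>) * \<tau>)) + p * (\<mu> * exp (\<mu> * \<tau>))) (at \<tau>)"
    by (auto intro!: derivative_eq_intros)
  show ?down
    by (rule quot[OF d_down]) (unfold N_def e1 e2, algebra)
  have d_both: "((\<lambda>a. (1 - p) * exp ((lam + \<mu>) * a)) has_real_derivative
      (1 - p) * ((lam + \<mu>) * exp ((lam + \<mu>) * \<tau>))) (at \<tau>)"
    by (auto intro!: derivative_eq_intros)
  show ?both
    by (rule quot[OF d_both]) (unfold N_def e1 e2, algebra)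
qed

theorem corollary4p1:
  fixes M :: "'a measure"
    and X :: "nat \<Rightarrow> 'a \<Rightarrow> nat"
    and U D :: "nat \<Rightarrow> 'a \<Rightarrow> real"
    and b r p c v lam \<mu> t x \<tau> s :: real
  assumes "b > 0" and "r > 0" and "p = b / (b + r)"
    and "c > 0" and "v > 0" and "lam > 0" and "\<mu> > 0"
    and "bernoulli_scheme M p X U D"
    and "\<And>k. 1 \<le> k \<Longrightarrow> distributed M lborel (U k) (exponential_density (lam * real k))"
    and "\<And>k. 1 \<le> k \<Longrightarrow> distributed M lborel (D k) (exponential_density (\<mu> * real k))"
    and "t > 0" and "- v * t < x" and "x < c * t"
    and "\<tau> = (v * t + x) / (c + v)"
    and "s = (c + v) / (lam + \<mu>)"
  shows "((\<lambda>y. \<P>(\<omega> in M. position X U D c v t \<omega> \<le> y \<bar> velocity X U D c v 0 \<omega> = c))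
            has_real_derivative
          (1 - p) / (c + v) *
          ((lam * (1 - p) * exp ((lam + 2 * \<mu>) * \<tau>)
             + p * exp (\<mu> * (t + \<tau>)) * ((lam + \<mu>) * exp (lam * \<tau>) - \<mu>))
           / (p * exp (\<mu> * t) + (1 - p) * exp ((lam + \<mu>) * \<tau>))\<^sup>2)) (at x)
       \<and> ((\<lambda>y. \<P>(\<omega> in M. position X U D c v t \<omega> \<le> y \<bar> velocity X U D c v 0 \<omega> = - v))
            has_real_derivative
          p / (c + v) *
          ((exp (\<mu> * (t + \<tau>)) * ((lam + \<mu>) * exp (lam * \<tau>) * (1 - p) + \<mu> * p)
             - lam * (1 - p) * exp ((lam + 2 * \<mu>) * \<tau>))
           / (p * exp (\<mu> * t) + (1 - p) * exp ((lam + \<mu>) * \<tau>))\<^sup>2)) (at x)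
       \<and> ((\<lambda>y. \<P>(\<omega> in M. position X U D c v t \<omega> \<le> y))
            has_real_derivative
          p / (1 - p) * (1 / s) *
          (exp ((\<mu> - v / s) * t - 1 / s * x)
           / (1 + p / (1 - p) * exp ((\<mu> - v / s) * t - 1 / s * x))\<^sup>2)) (at x)"
proof -
  have p: "0 < p" "p < 1"
    unfolding assms(3) using assms(1,2) by simp_all
  interpret yule_telegraph M p X U D lam \<mu>
    using assms p by (simp add: yule_telegraph_def yule_telegraph_axioms_def)
  note vel = \<open>c > 0\<close> \<open>v > 0\<close>
  define T where "T = exp (\<mu> * t)"
  have T: "0 < T" by (simp add: T_def)
  define N where "N = (\<lambda>a. p * T + (1 - p) * exp ((lam + \<mu>) * a))"
  have N_apply: "N a = p * T + (1 - p) * exp ((lam + \<mu>) * a)" for a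
    by (simp add: N_def)
  define pos where "pos = (\<lambda>y. (v * t + y) / (c + v))"
  have pos_x: "pos x = \<tau>" using assms(14) by (simp add: pos_def)
  have N: "0 < N \<tau>" unfolding N_def using p T by (intro add_pos_pos) auto
  \<comment> \<open>the formulas for the distribution functions are valid on an open interval around \<open>x\<close>\<close>
  have in_terms_of_\<tau>: "(f has_real_derivative D / (c + v)) (at x)"
    if F: "(F has_real_derivative D) (at \<tau>)"
      and eq: "\<And>y. - v * t < y \<Longrightarrow> y < c * t \<Longrightarrow> F (pos y) = f y" for f F D
  proof (rule has_field_derivative_transform_within_open[of "\<lambda>y. F (pos y)"])
    have "(pos has_real_derivative 1 / (c + v)) (at x)"
      unfolding pos_def using vel by (auto intro!: derivative_eq_intros)
    from DERIV_chain2[OF F[folded pos_x] this] show "((\<lambda>y. F (pos y)) has_real_derivative D / (c + v)) (at x)"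
      by simp
    show "x \<in> {- v * t<..<c * t}" using assms(12,13) by simp
  qed (use eq in auto)
  note cdfs = position_cdf_up[OF vel \<open>t > 0\<close>] position_cdf_down[OF vel \<open>t > 0\<close>] position_cdf[OF vel \<open>t > 0\<close>]
  note derivs = has_real_derivative_cdf_quotients[OF p T, where lam = lam and \<mu> = \<mu> and \<tau> = \<tau>, folded N_apply]
  have exp_shift: "exp (\<mu> * (t + \<tau>)) = T * exp (\<mu> * \<tau>)"
    by (simp add: T_def exp_add[symmetric] algebra_simps)
  have up: "((\<lambda>y. \<P>(\<omega> in M. position X U D c v t \<omega> \<le> y \<bar> velocity X U D c v 0 \<omega> = c))
      has_real_derivative (1 - p) * (lam * (1 - p) * exp ((lam + 2 * \<mu>) * \<tau>)
        + p * (T * exp (\<mu> * \<tau>)) * ((lam + \<mu>) * exp (lam * \<tau>) - \<mu>)) / (N \<tau>)\<^sup>2 / (c + v)) (at x)"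
    using p by (intro in_terms_of_\<tau>[OF derivs(1)])
      (simp add: cond_prob_def prob_initial_velocity[OF vel] cdfs(1)[OF _ _ refl] N_def T_def pos_def)
  have down: "((\<lambda>y. \<P>(\<omega> in M. position X U D c v t \<omega> \<le> y \<bar> velocity X U D c v 0 \<omega> = - v))
      has_real_derivative p * (T * exp (\<mu> * \<tau>) * ((lam + \<mu>) * exp (lam * \<tau>) * (1 - p) + \<mu> * p)
        - lam * (1 - p) * exp ((lam + 2 * \<mu>) * \<tau>)) / (N \<tau>)\<^sup>2 / (c + v)) (at x)"
    using p by (intro in_terms_of_\<tau>[OF derivs(2)])
      (simp add: cond_prob_def prob_initial_velocity[OF vel] cdfs(2)[OF _ _ refl] N_def T_def pos_def)
  have both: "((\<lambda>y. \<P>(\<omega> in M. position X U D c v t \<omega> \<le> y))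
      has_real_derivative p * T * (1 - p) * (lam + \<mu>) * exp ((lam + \<mu>) * \<tau>) / (N \<tau>)\<^sup>2 / (c + v)) (at x)"
    by (intro in_terms_of_\<tau>[OF derivs(3)]) (simp add: cdfs(3)[OF _ _ refl] N_def T_def pos_def)
  define E where "E = exp ((lam + \<mu>) * \<tau>)"
  have E: "0 < E" by (simp add: E_def)
  have "(lam + \<mu>) * \<tau> = (v * t + x) / s"
    by (simp add: assms(14,15) mult.commute)
  then have "(\<mu> - v / s) * t - 1 / s * x = \<mu> * t - (lam + \<mu>) * \<tau>"
    by (simp add: left_diff_distrib add_divide_distrib)
  then have exponent: "exp ((\<mu> - v / s) * t - 1 / s * x) = T / E"
    by (simp add: exp_diff T_def E_def)
  define Q where "Q = 1 + p / (1 - p) * (T / E)"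
  have NE: "N \<tau> = (1 - p) * E * Q"
    using p E unfolding N_def Q_def E_def[symmetric] by (simp add: field_simps)
  have "Q > 0"
    unfolding Q_def using p E T by (intro add_pos_pos) auto
  define m where "m = 1 - p"
  have "m > 0" using p by (simp add: m_def)
  have logistic: "p * T * (1 - p) * (lam + \<mu>) * E / (N \<tau>)\<^sup>2 / (c + v)
      = p / (1 - p) * (1 / s) * (T / E / Q\<^sup>2)"
    unfolding NE assms(15) m_def[symmetric]
    using \<open>m > 0\<close> \<open>Q > 0\<close> E vel by (simp add: power2_eq_square mult_ac)
  show ?thesis
    using up down both
    unfolding exp_shift exponent Q_def[symmetric] logistic[symmetric] E_def[symmetric] T_def[symmetric]
    by (simp add: N_def E_def mult.commute)
qed

end
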